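(* Let $d=1$, $K=1$, $N\ge3$, and let $\zeta$ be a real random variable for which there are $R_+,R_-\in\mathbb{R}$ and a constant $C\ge0$ such that: for all $a\ge R_+$ and $u>0$, $$\mathbb{P}(a+u<\zeta\le a+2u)\le C\,\mathbb{P}(a<\zeta\le a+u),$$ and for all $a\le R_-$ and $u<0$, $$\mathbb{P}(a+2u<\zeta\le a+u)\le C\,\mathbb{P}(a+u<\zeta\le a).$$ Consider the Jante's law process with parameters $N,K=1,\zeta$, with core $\mathcal{X}'(t)$ and $F(t)=G_{N-1}(\mathcal{X}'(t))$, and let $x_{(1)}(t)$ and $x_{(N-1)}(t)$ be the left-most and the right-most points of $\mathcal{X}'(t)$. Then: (i) almost surely $\mathcal{X}'(t)\not\to\infty$, and consequently $F(t)\to0$ almost surely. (ii) Up to a set of probability zero, $$\left\{\liminf_{t\to\infty}x_{(1)}(t)>R_+\right\}\cup\left\{\limsup_{t\to\infty}x_{(N-1)}(t)<R_-\right\}\subseteq\{\mathcal{X}'(t)\to\phi\text{ for some }\phi\in\mathbb{R}\}.$$ (iii) If $R_->R_+$, then $\mathbb{P}(\mathcal{X}'(t)\to\phi\text{ for some }\phi\in\mathbb{R})=1$.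
   Context: Notation: $\operatorname{supp}\zeta=\{x\in\mathbb{R}:\ \mathbb{P}(|\zeta-x|<\varepsilon)>0\ \forall\varepsilon>0\}$. For points $x_1,\dots,x_n\in\mathbb{R}$ let $\mu_n(x_1,\dots,x_n)=\frac1n\sum_{i=1}^n x_i$ and $G_n(x_1,\dots,x_n)=\frac1n\sum_{i=1}^n\sum_{j=1}^{i-1}|x_i-x_j|^2=\sum_{i=1}^n|x_i-\mu_n|^2$. Core (for $K=1$): given a configuration (finite multiset) of $N$ points, its core is a subconfiguration of $N-1$ of these points which minimizes $G_{N-1}$ among all subconfigurations of size $N-1$; if there are several minimizers, one of them is chosen with equal probability. Jante's law process with parameters $N,K=1,\zeta$: the initial configuration $\mathcal{X}(0)$ consists of $N$ distinct points of $\operatorname{supp}\zeta$ (arbitrary or random). Let $\zeta_t$, $t=1,2,\dots$, be i.i.d. with the distribution of $\zeta$, independent of the initial configuration. Given $\mathcal{X}(t)$, let $\mathcal{X}'(t)$ be its core, and set $\mathcal{X}(t+1)=\mathcal{X}'(t)\cup\{\zeta_{t+1}\}$ (points counted with multiplicity). We write $\mathcal{X}'(t)\to\phi$ if all the elements of $\mathcal{X}'(t)$ converge to $\phi$ as $t\to\infty$, and $\mathcal{X}'(t)\to\infty$ if $\min\{|x|:\ x\in\mathcal{X}'(t)\}\to\infty$; $\mathcal{X}'(t)\not\to\infty$ means that the latter fails. *)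

theory Defs
  imports "HOL-Probability.Probability" "HOL-Library.Multiset"
begin

definition rv_supp :: "'b measure \<Rightarrow> ('b \<Rightarrow> real) \<Rightarrow> real set" where
  "rv_supp D \<zeta> = {x. \<forall>\<epsilon>>0. \<P>(\<omega> in D. \<bar>\<zeta> \<omega> - x\<bar> < \<epsilon>) > 0}"

definition config_mean :: "real multiset \<Rightarrow> real" where
  "config_mean X = sum_mset X / real (size X)"

definition config_G :: "real multiset \<Rightarrow> real" where
  "config_G X = (\<Sum>x\<in>#X. \<bar>x - config_mean X\<bar> ^ 2)"

lemma sum_pairs_sq:
  fixes f :: "nat \<Rightarrow> real"
  shows "(\<Sum>i<n. \<Sum>j<i. (f i - f j)^2) = real n * (\<Sum>i<n. (f i)^2) - (\<Sum>i<n. f i)^2"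
proof (induction n)
  case (Suc n)
  have "(\<Sum>j<n. (f n - f j)^2) = real n * (f n)^2 - 2 * f n * (\<Sum>j<n. f j) + (\<Sum>j<n. (f j)^2)"
    by (simp add: power2_diff sum.distrib sum_subtractf sum_distrib_left)
  with Suc show ?case
    by (simp add: algebra_simps power2_eq_square)
qed simp

lemma config_G_pairwise:
  "config_G (mset xs) =
     1 / real (length xs) * (\<Sum>i<length xs. \<Sum>j<i. \<bar>xs ! i - xs ! j\<bar> ^ 2)"
proof (cases "xs = []")
  case False
  define n where "n = length xs"
  define S where "S = (\<Sum>i<n. xs ! i)"
  have n: "real n > 0" using False by (simp add: n_def)
  have S: "sum_mset (mset xs) = S"
    by (simp add: S_def n_def sum_mset_sum_list sum_list_sum_nth atLeast0LessThan)
  have "config_G (mset xs) = (\<Sum>i<n. (xs ! i - S / real n)^2)"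
    by (simp add: config_G_def config_mean_def S flip: n_def mset_map)
       (simp add: sum_mset_sum_list sum_list_sum_nth atLeast0LessThan n_def flip: mset_map)
  also have "\<dots> = (\<Sum>i<n. (xs ! i)^2 - 2 * (S / real n) * xs ! i + (S / real n)^2)"
    by (simp add: power2_diff algebra_simps)
  also have "\<dots> = (\<Sum>i<n. (xs ! i)^2) - 2 * (S / real n) * S + real n * (S / real n)^2"
    by (simp add: sum.distrib sum_subtractf S_def sum_distrib_left sum_divide_distrib)
  also have "\<dots> = (\<Sum>i<n. (xs ! i)^2) - S^2 / real n"
    using n by (simp add: power2_eq_square field_simps)
  also have "\<dots> = 1 / real n * (real n * (\<Sum>i<n. (xs ! i)^2) - S^2)"
    using n by (simp add: field_simps)
  finally show ?thesis
    by (simp add: sum_pairs_sq S_def flip: n_def)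
qed (simp add: config_G_def)

text \<open>The possible cores of a configuration. Subconfigurations are compared as multisets, so
  deleting either of two coinciding points gives the same candidate.\<close>

definition cores :: "real multiset \<Rightarrow> real multiset set" where
  "cores X = {Y. is_arg_min config_G (\<lambda>Y. Y \<subseteq># X \<and> Suc (size Y) = size X) Y}"

text \<open>The usual point-process \<open>\<sigma>\<close>-algebra, generated by the counting maps.\<close>

definition config_space :: "real multiset measure" where
  "config_space = sigma UNIV
     {{X. size (filter_mset (\<lambda>x. x \<in> B) X) = n} | B n. B \<in> sets borel}"

text \<open>The information available when the tie between the possible cores at time \<open>t\<close> is broken:
  the initial configuration, the earlier choices of the core, and the whole sequence
  \<open>Z 1, Z 2, \<dots>\<close>. Including the values after time \<open>t\<close> expresses that the tie-breaking
  randomness is independent of the sampled points.\<close>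

definition tie_history ::
  "'a measure \<Rightarrow> ('a \<Rightarrow> real multiset) \<Rightarrow> (nat \<Rightarrow> 'a \<Rightarrow> real multiset) \<Rightarrow> (nat \<Rightarrow> 'a \<Rightarrow> real)
    \<Rightarrow> nat \<Rightarrow> 'a measure" where
  "tie_history M X0 X' Z t = sigma (space M)
     ({X0 -` A \<inter> space M | A. A \<in> sets config_space} \<union>
      {X' s -` A \<inter> space M | s A. s < t \<and> A \<in> sets config_space} \<union>
      {Z s -` B \<inter> space M | s B. 1 \<le> s \<and> B \<in> sets borel})"

text \<open>Here \<open>X t\<close>, \<open>X' t\<close> and \<open>Z t\<close> are the configuration, its core and the newly sampled
  point at time \<open>t\<close>; \<open>Z 0\<close> is irrelevant. Assumption \<open>core_uniform\<close> says that, conditionally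
  on \<open>tie_history\<close>, the core is uniformly distributed on the set of minimizers.\<close>

locale jante_process = prob_space M
  for M :: "'a measure"
    and N :: nat
    and D :: "'b measure" and \<zeta> :: "'b \<Rightarrow> real"
    and X X' :: "nat \<Rightarrow> 'a \<Rightarrow> real multiset"
    and Z :: "nat \<Rightarrow> 'a \<Rightarrow> real" +
  assumes X_measurable: "\<And>t. X t \<in> measurable M config_space"
    and X'_measurable: "\<And>t. X' t \<in> measurable M config_space"
    and Z_indep: "indep_vars (\<lambda>_. borel) Z {1..}"
    and Z_distr: "\<And>t. 1 \<le> t \<Longrightarrow> distr M borel (Z t) = distr D borel \<zeta>"
    and Z_indep_init:
      "indep_set {X 0 -` A \<inter> space M | A. A \<in> sets config_space}
        {(\<lambda>\<omega>. \<lambda>t\<in>{1..}. Z t \<omega>) -` B \<inter> space M | B. B \<in> sets (PiM {1..} (\<lambda>_. borel))}"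
    and init: "\<And>\<omega>. \<omega> \<in> space M \<Longrightarrow>
      \<exists>S. finite S \<and> card S = N \<and> S \<subseteq> rv_supp D \<zeta> \<and> X 0 \<omega> = mset_set S"
    and core: "\<And>t \<omega>. \<omega> \<in> space M \<Longrightarrow> X' t \<omega> \<in> cores (X t \<omega>)"
    and core_uniform: "\<And>t A. A \<in> sets config_space \<Longrightarrow>
      AE \<omega> in M. real_cond_exp M (tie_history M (X 0) X' Z t) (indicator (X' t -` A \<inter> space M)) \<omega>
        = measure_pmf.prob (pmf_of_set (cores (X t \<omega>))) A"
    and step: "\<And>t \<omega>. \<omega> \<in> space M \<Longrightarrow> X (Suc t) \<omega> = add_mset (Z (Suc t) \<omega>) (X' t \<omega>)"

definition configs_tendsto :: "(nat \<Rightarrow> real multiset) \<Rightarrow> real \<Rightarrow> bool" where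
  "configs_tendsto Y \<phi> \<longleftrightarrow> (\<forall>\<epsilon>>0. \<forall>\<^sub>F t in sequentially. \<forall>x\<in>#Y t. \<bar>x - \<phi>\<bar> < \<epsilon>)"

definition configs_to_infinity :: "(nat \<Rightarrow> real multiset) \<Rightarrow> bool" where
  "configs_to_infinity Y \<longleftrightarrow> filterlim (\<lambda>t. Min (abs ` set_mset (Y t))) at_top sequentially"

end

theory Submission
  imports Defs
begin

text \<open>
Let \<open>F t\<close> be the value of \<open>config_G\<close> at the core \<open>X' t\<close>, and let \<open>s t\<close> be its square root.
Since the old core is always a candidate for the new one, \<open>F\<close> decreases along every path,
and the diameter of the core is at most \<open>sqrt 2 * s t\<close>. The proof compares two kinds of
samples.

\<^item> Contracting samples: if the sample is within a small multiple of \<open>s t\<close> of the point of the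
  core that is nearest to the mean, then \<open>F\<close> drops by a factor less than one that depends
  only on \<open>N\<close> (\<open>near_central_point_contracting\<close>).

\<^item> Outward jumps: the right end of the core moves to the right only if the sample lands at
  most \<open>sqrt 2 * s t\<close> to the right of it (\<open>Max_increase\<close>), and the same holds for the left
  end.

If the core lies to the right of \<open>Rp\<close>, then iterating the doubling hypothesis a bounded
number of times, from a neighbourhood of the central point out to the jump interval, shows
that an outward jump is at most \<open>K\<close> times as likely as a contraction (\<open>right_jump_mass\<close>).
Jumps have size at most a multiple of \<open>s t\<close>, and a contraction lowers \<open>s\<close> by a fixed
fraction of \<open>s t\<close>. Therefore the expected total of the jumps is bounded by a multiple of the
total decrease of \<open>s\<close>, which is finite (\<open>summable_weighted_visits\<close>, \<open>AE_summable_right\<close>). So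
almost surely the right end travels a finite total distance to the right during the times
when the core is to the right of \<open>Rp\<close>. If the core eventually stays there, its right end is
also bounded below, hence it converges. The left end is treated in the same way to the left
of \<open>Rm\<close> (\<open>AE_convergent\<close>).

A core that tends to infinity eventually stays on one side of the origin, because its
diameter and its jumps are bounded; there one of its ends would have to converge, which is
impossible. If \<open>F\<close> stayed above a positive level without the core tending to infinity, then
the core would be in some bounded region infinitely often. On the bounded part of the
support the probability of a contraction is bounded away from zero, so the same charging
argument allows only finitely many such times (\<open>AE_finitely_many_bounded_visits\<close>). This
proves the first part, and with \<open>F\<close> tending to \<open>0\<close> convergence of one end is convergence of
the whole core, which is the second part. If \<open>Rp < Rm\<close>, then each passage of the core from
below \<open>Rp\<close> to above \<open>Rm\<close> would eventually use up a fixed amount of the finite distance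
available to the right end, so the core is eventually to the right of \<open>Rp\<close> or eventually to
the left of \<open>Rm\<close> (\<open>eventually_one_sided\<close>), and the second part applies.

The only probabilistic input is that the core at time \<open>t\<close> is independent of the sample at
time \<open>t + 1\<close> (\<open>distr_core_sample\<close>). The core is chosen at random among minimizers, with a
conditional law that is a measurable function of the current configuration, and the
independence follows by induction on \<open>t\<close>.
\<close>

section \<open>The measurable space of configurations\<close>

lemma space_config_space [simp]: "space config_space = UNIV"
  by (simp add: config_space_def space_measure_of_conv)

lemma measurable_config_count:
  assumes "B \<in> sets borel"
  shows "(\<lambda>X. size (filter_mset (\<lambda>x. x \<in> B) X)) \<in> measurable config_space (count_space UNIV)"
proof (subst measurable_count_space_eq2_countable, safe)
  fix n :: nat
  have "(\<lambda>X. size (filter_mset (\<lambda>x. x \<in> B) X)) -` {n} \<inter> space config_space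
      = {X. size (filter_mset (\<lambda>x. x \<in> B) X) = n}"
    by auto
  also have "\<dots> \<in> sets config_space"
    unfolding config_space_def using assms by (subst sets_measure_of) (auto intro!: sigma_sets.Basic)
  finally show "(\<lambda>X. size (filter_mset (\<lambda>x. x \<in> B) X)) -` {n} \<inter> space config_space \<in> sets config_space" .
qed auto

lemma measurable_config_spaceI:
  assumes "\<And>B. B \<in> sets borel \<Longrightarrow>
    (\<lambda>w. size (filter_mset (\<lambda>x. x \<in> B) (f w))) \<in> measurable W (count_space UNIV)"
  shows "f \<in> measurable W config_space"
  unfolding config_space_def
proof (rule measurable_measure_of)
  fix A assume "A \<in> {{X. size (filter_mset (\<lambda>x. x \<in> B) X) = n} |B n. B \<in> sets (borel :: real measure)}"
  then obtain B n where A: "A = {X. size (filter_mset (\<lambda>x. x \<in> B) X) = n}" and B: "B \<in> sets borel"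
    by blast
  have "f -` A \<inter> space W = (\<lambda>w. size (filter_mset (\<lambda>x. x \<in> B) (f w))) -` {n} \<inter> space W"
    by (auto simp: A)
  also have "\<dots> \<in> sets W"
    using measurable_sets[OF assms[OF B]] by simp
  finally show "f -` A \<inter> space W \<in> sets W" .
qed auto

lemma measurable_config_size [measurable]:
  "size \<in> measurable config_space (count_space UNIV)"
  using measurable_config_count[of UNIV] by simp

lemma measurable_config_add [measurable (raw)]:
  assumes [measurable]: "g \<in> borel_measurable W" and f: "f \<in> measurable W config_space"
  shows "(\<lambda>w. add_mset (g w) (f w)) \<in> measurable W config_space"
proof (rule measurable_config_spaceI)
  fix B :: "real set" assume B [measurable]: "B \<in> sets borel"
  have [measurable]: "(\<lambda>w. size (filter_mset (\<lambda>x. x \<in> B) (f w))) \<in> measurable W (count_space UNIV)"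
    using measurable_compose[OF f measurable_config_count[OF B]] .
  have "(\<lambda>w. size (filter_mset (\<lambda>x. x \<in> B) (add_mset (g w) (f w))))
      = (\<lambda>w. size (filter_mset (\<lambda>x. x \<in> B) (f w)) + (if g w \<in> B then 1 else 0))"
    by auto
  also have "\<dots> \<in> measurable W (count_space UNIV)"
    by measurable
  finally show "(\<lambda>w. size (filter_mset (\<lambda>x. x \<in> B) (add_mset (g w) (f w))))
      \<in> measurable W (count_space UNIV)" .
qed

lemma size_filter_eq_0: "size (filter_mset P X) = 0 \<longleftrightarrow> (\<forall>x\<in>#X. \<not> P x)"
  by (induction X) auto

text \<open>Order statistics reduce every functional of a configuration that occurs below to finitely many
real-valued random variables. They are measurable because \<open>nth_point i X \<le> c\<close> is a statement
about the number of points of \<open>X\<close> in \<open>{..c}\<close>. The value \<open>0\<close> beyond the size only makes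
the function total.\<close>

definition nth_point :: "nat \<Rightarrow> real multiset \<Rightarrow> real" where
  "nth_point i X = (if i < size X then sorted_list_of_multiset X ! i else 0)"

lemma length_sorted_list_of_multiset [simp]: "length (sorted_list_of_multiset X) = size X"
  by (metis mset_sorted_list_of_multiset size_mset)

lemma nth_point_in: "i < size X \<Longrightarrow> nth_point i X \<in># X"
  by (metis length_sorted_list_of_multiset mset_sorted_list_of_multiset nth_mem nth_point_def set_mset_mset)

lemma in_multiset_iff_nth_point: "x \<in># X \<longleftrightarrow> (\<exists>i<size X. x = nth_point i X)"
  by (metis in_set_conv_nth length_sorted_list_of_multiset nth_point_def nth_point_in
      set_sorted_list_of_multiset)

lemma sum_mset_nth_point: "(\<Sum>x\<in>#X. (g x :: real)) = (\<Sum>i<size X. g (nth_point i X))"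
proof -
  let ?xs = "sorted_list_of_multiset X"
  have "(\<Sum>x\<in>#X. g x) = sum_list (map g ?xs)"
    by (metis mset_map mset_sorted_list_of_multiset sum_mset_sum_list)
  also have "\<dots> = (\<Sum>i<size X. g (?xs ! i))"
    by (simp add: sum_list_sum_nth atLeast0LessThan)
  finally show ?thesis by (simp add: nth_point_def)
qed

lemma filter_le_eq_takeWhile:
  fixes c :: real
  assumes "sorted xs"
  shows "filter (\<lambda>x. x \<le> c) xs = takeWhile (\<lambda>x. x \<le> c) xs"
  using assms by (induction xs) (fastforce simp: filter_empty_conv takeWhile_eq_Nil_iff dest: hd_in_set)+

text \<open>In an increasing list the entries that are at most \<open>c\<close> form an initial segment, whose length is
the count of points in \<open>{..c}\<close>.\<close>

lemma nth_point_le_iff: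
  assumes "i < size X"
  shows "nth_point i X \<le> c \<longleftrightarrow> i < size (filter_mset (\<lambda>x. x \<in> {..c}) X)"
proof -
  let ?xs = "sorted_list_of_multiset X"
  have s: "sorted ?xs" by simp
  have "size (filter_mset (\<lambda>x. x \<in> {..c}) X) = length (filter (\<lambda>x. x \<le> c) ?xs)"
    by (metis (no_types, lifting) atMost_iff filter_cong mset_filter mset_sorted_list_of_multiset size_mset)
  also have "filter (\<lambda>x. x \<le> c) ?xs = takeWhile (\<lambda>x. x \<le> c) ?xs"
    using s by (rule filter_le_eq_takeWhile)
  finally have *: "size (filter_mset (\<lambda>x. x \<in> {..c}) X) = length (takeWhile (\<lambda>x. x \<le> c) ?xs)" .
  have "?xs ! i \<le> c \<longleftrightarrow> i < length (takeWhile (\<lambda>x. x \<le> c) ?xs)"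
  proof
    assume "?xs ! i \<le> c"
    show "i < length (takeWhile (\<lambda>x. x \<le> c) ?xs)"
    proof (rule ccontr)
      assume "\<not> i < length (takeWhile (\<lambda>x. x \<le> c) ?xs)"
      let ?j = "length (takeWhile (\<lambda>x. x \<le> c) ?xs)"
      have j: "?j \<le> i" "?j < length ?xs"
        using assms \<open>\<not> _\<close> by simp_all
      have "\<not> ?xs ! ?j \<le> c" using nth_length_takeWhile[OF j(2)] by simp
      moreover have "?xs ! ?j \<le> ?xs ! i" using s j(1) assms by (simp add: sorted_nth_mono)
      ultimately show False using \<open>?xs ! i \<le> c\<close> by simp
    qed
  next
    assume "i < length (takeWhile (\<lambda>x. x \<le> c) ?xs)"
    then show "?xs ! i \<le> c"
      by (metis nth_mem set_takeWhileD takeWhile_nth)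
  qed
  with * assms show ?thesis by (simp add: nth_point_def)
qed

lemma measurable_nth_point [measurable]: "nth_point i \<in> borel_measurable config_space"
proof (rule borel_measurableI_le)
  fix c :: real
  have [measurable]: "(\<lambda>X. size (filter_mset (\<lambda>x. x \<in> {..c}) X)) \<in> measurable config_space (count_space UNIV)"
    by (rule measurable_config_count) simp
  have "{X \<in> space config_space. nth_point i X \<le> c}
      = {X \<in> space config_space. if i < size X then i < size (filter_mset (\<lambda>x. x \<in> {..c}) X) else 0 \<le> c}"
    using nth_point_le_iff[of i _ c] by (auto simp: nth_point_def)
  also have "\<dots> \<in> sets config_space"
    by measurable
  finally show "{X \<in> space config_space. nth_point i X \<le> c} \<in> sets config_space" .
qed

definition drop_point :: "nat \<Rightarrow> real multiset \<Rightarrow> real multiset" where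
  "drop_point i X = (if i < size X then X - {#nth_point i X#} else X)"

lemma measurable_drop_point [measurable]: "drop_point i \<in> measurable config_space config_space"
proof (rule measurable_config_spaceI)
  fix B :: "real set" assume B [measurable]: "B \<in> sets borel"
  note [measurable] = measurable_config_count[OF B]
  have "size (filter_mset (\<lambda>x. x \<in> B) (drop_point i X))
      = size (filter_mset (\<lambda>x. x \<in> B) X) - (if i < size X \<and> nth_point i X \<in> B then 1 else 0)"
    (is "?l X = ?r X") for X
  proof (cases "i < size X")
    case True
    then obtain x Y where "x = nth_point i X" "X = add_mset x Y"
      using nth_point_in mset_add by metis
    then show ?thesis using True by (auto simp: drop_point_def)
  qed (simp add: drop_point_def)
  then have "?l = ?r" by auto
  then show "?l \<in> measurable config_space (count_space UNIV)"
    by simp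
qed

lemma measurable_sum_mset [measurable]:
  assumes [measurable]: "g \<in> borel_measurable borel"
  shows "(\<lambda>X. \<Sum>x\<in>#X. (g x :: real)) \<in> borel_measurable config_space"
proof -
  have "(\<lambda>X. \<Sum>i<size X. g (nth_point i X)) \<in> borel_measurable config_space"
    by (rule measurable_compose_countable[where f = "\<lambda>k X. \<Sum>i<k. g (nth_point i X)"]) measurable
  then show ?thesis by (simp add: sum_mset_nth_point)
qed

lemma measurable_config_mean [measurable]: "config_mean \<in> borel_measurable config_space"
proof -
  have "config_mean = (\<lambda>X. (\<Sum>x\<in>#X. x) / real (size X))"
    by (auto simp: config_mean_def)
  moreover have "(\<lambda>X. (\<Sum>x\<in>#X. x) / real (size X)) \<in> borel_measurable config_space"
    by measurable
  ultimately show ?thesis by simp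
qed

lemma measurable_config_G [measurable]: "config_G \<in> borel_measurable config_space"
proof -
  have "config_G X = (\<Sum>i<size X. \<bar>nth_point i X - config_mean X\<bar> ^ 2)" for X
    by (simp add: config_G_def sum_mset_nth_point)
  moreover have "(\<lambda>X. \<Sum>i<size X. \<bar>nth_point i X - config_mean X\<bar> ^ 2) \<in> borel_measurable config_space"
    by (rule measurable_compose_countable
          [where f = "\<lambda>k X. \<Sum>i<k. \<bar>nth_point i X - config_mean X\<bar> ^ 2"]) measurable
  ultimately show ?thesis by (simp cong: measurable_cong)
qed

lemma measurable_config_Max [measurable]:
  "(\<lambda>X. Max (set_mset X)) \<in> borel_measurable config_space"
proof (rule borel_measurableI_le)
  fix c :: real
  have [measurable]: "(\<lambda>X. size (filter_mset (\<lambda>x. x \<in> {c<..}) X)) \<in> measurable config_space (count_space UNIV)"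
    by (rule measurable_config_count) simp
  have "Max (set_mset X) \<le> c \<longleftrightarrow>
      (if size X = 0 then Max {} \<le> c else size (filter_mset (\<lambda>x. x \<in> {c<..}) X) = 0)" for X :: "real multiset"
    by (auto simp: not_less size_filter_eq_0)
  then have "{X \<in> space config_space. Max (set_mset X) \<le> c}
      = {X \<in> space config_space. if size X = 0 then Max {} \<le> c else size (filter_mset (\<lambda>x. x \<in> {c<..}) X) = 0}"
    by blast
  also have "\<dots> \<in> sets config_space"
    by measurable
  finally show "{X \<in> space config_space. Max (set_mset X) \<le> c} \<in> sets config_space" .
qed

lemma measurable_config_Min [measurable]:
  "(\<lambda>X. Min (set_mset X)) \<in> borel_measurable config_space"
proof (rule borel_measurableI_ge)
  fix c :: real
  have [measurable]: "(\<lambda>X. size (filter_mset (\<lambda>x. x \<in> {..<c}) X)) \<in> measurable config_space (count_space UNIV)"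
    by (rule measurable_config_count) simp
  have "c \<le> Min (set_mset X) \<longleftrightarrow>
      (if size X = 0 then c \<le> Min {} else size (filter_mset (\<lambda>x. x \<in> {..<c}) X) = 0)" for X :: "real multiset"
    by (auto simp: not_less size_filter_eq_0)
  then have "{X \<in> space config_space. c \<le> Min (set_mset X)}
      = {X \<in> space config_space. if size X = 0 then c \<le> Min {} else size (filter_mset (\<lambda>x. x \<in> {..<c}) X) = 0}"
    by blast
  also have "\<dots> \<in> sets config_space"
    by measurable
  finally show "{X \<in> space config_space. c \<le> Min (set_mset X)} \<in> sets config_space" .
qed

text \<open>Distinct values of \<open>f\<close> are counted at the first index where they occur. This is needed
because different indices \<open>i\<close> may give the same core \<open>drop_point i X\<close> when points coincide,
while the tie between cores is broken uniformly among distinct multisets.\<close>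

lemma card_image_eq_sum_first:
  fixes f :: "nat \<Rightarrow> 'c"
  shows "real (card (f ` {i. i < n \<and> P i}))
    = (\<Sum>i<n. if P i \<and> (\<forall>j<i. P j \<longrightarrow> f j \<noteq> f i) then 1 else 0)"
proof -
  let ?I = "{i. i < n \<and> P i \<and> (\<forall>j<i. P j \<longrightarrow> f j \<noteq> f i)}"
  have "f ` {i. i < n \<and> P i} = f ` ?I"
  proof (intro equalityI subsetI)
    fix y assume "y \<in> f ` {i. i < n \<and> P i}"
    then have ex: "\<exists>i. i < n \<and> P i \<and> f i = y" by auto
    define i where "i = (LEAST i. i < n \<and> P i \<and> f i = y)"
    have i: "i < n \<and> P i \<and> f i = y" unfolding i_def by (rule LeastI_ex[OF ex])
    moreover have "\<forall>j<i. P j \<longrightarrow> f j \<noteq> f i"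
      using i not_less_Least[of _ "\<lambda>i. i < n \<and> P i \<and> f i = y"] unfolding i_def[symmetric]
      by (metis order.strict_trans)
    ultimately show "y \<in> f ` ?I" by auto
  qed auto
  moreover have "inj_on f ?I"
    by (rule inj_onI) (metis (mono_tags, lifting) linorder_neqE_nat mem_Collect_eq)
  ultimately have "card (f ` {i. i < n \<and> P i}) = card ?I"
    by (simp add: card_image)
  also have "real \<dots> = (\<Sum>i\<in>?I. 1)" by simp
  also have "\<dots> = (\<Sum>i<n. if P i \<and> (\<forall>j<i. P j \<longrightarrow> f j \<noteq> f i) then 1 else 0)"
    by (subst sum.inter_filter[symmetric]) (auto intro!: sum.cong)
  finally show ?thesis .
qed

section \<open>Cores and the uniform choice among them\<close>

lemma subconfig_iff_remove:
  "Y \<subseteq># X \<and> Suc (size Y) = size X \<longleftrightarrow> (\<exists>x\<in>#X. Y = X - {#x#})"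
proof
  assume *: "Y \<subseteq># X \<and> Suc (size Y) = size X"
  then have "size (X - Y) = 1" by (simp add: size_Diff_submset flip: *[THEN conjunct2])
  then obtain x where "X - Y = {#x#}" using size_1_singleton_mset by blast
  with * have "X = Y + {#x#}" by (metis subset_mset.add_diff_inverse)
  then show "\<exists>x\<in>#X. Y = X - {#x#}" by auto
next
  assume "\<exists>x\<in>#X. Y = X - {#x#}"
  then obtain x where x: "x \<in># X" and Y: "Y = X - {#x#}" by blast
  from x obtain Z where "X = add_mset x Z" using mset_add by metis
  with Y show "Y \<subseteq># X \<and> Suc (size Y) = size X" by simp
qed

lemma cores_iff:
  "Y \<in> cores X \<longleftrightarrow>
    (\<exists>x\<in>#X. Y = X - {#x#}) \<and> (\<forall>x\<in>#X. config_G Y \<le> config_G (X - {#x#}))"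
  unfolding cores_def is_arg_min_def subconfig_iff_remove by (auto simp: not_less)

lemma cores_nth_point:
  "cores X = (\<lambda>i. drop_point i X) `
     {i. i < size X \<and> (\<forall>j<size X. config_G (drop_point i X) \<le> config_G (drop_point j X))}"
  (is "_ = ?R")
proof (intro equalityI subsetI)
  fix Y assume Y: "Y \<in> cores X"
  then obtain i where i: "i < size X" "Y = X - {#nth_point i X#}"
    unfolding cores_iff by (auto simp: in_multiset_iff_nth_point)
  then have "Y = drop_point i X" by (simp add: drop_point_def)
  moreover have "\<forall>j<size X. config_G Y \<le> config_G (drop_point j X)"
    using Y unfolding cores_iff by (auto simp: drop_point_def nth_point_in)
  ultimately show "Y \<in> ?R" using i by auto
next
  fix Y assume "Y \<in> ?R"
  then obtain i where i: "i < size X" "Y = drop_point i X"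
    and m: "\<forall>j<size X. config_G Y \<le> config_G (drop_point j X)" by auto
  have "\<exists>x\<in>#X. Y = X - {#x#}"
    using i nth_point_in[of i X] by (auto simp: drop_point_def)
  moreover have "\<forall>x\<in>#X. config_G Y \<le> config_G (X - {#x#})"
    using m by (auto simp: in_multiset_iff_nth_point drop_point_def)
  ultimately show "Y \<in> cores X" by (auto simp: cores_iff)
qed

lemma finite_cores [simp]: "finite (cores X)"
  by (simp add: cores_nth_point)

lemma cores_nonempty:
  assumes "X \<noteq> {#}"
  shows "cores X \<noteq> {}"
proof -
  obtain x where "is_arg_min (\<lambda>x. config_G (X - {#x#})) (\<lambda>x. x \<in> set_mset X) x"
    using ex_is_arg_min_if_finite[of "set_mset X" "\<lambda>x. config_G (X - {#x#})"] assms by auto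
  then have "X - {#x#} \<in> cores X"
    unfolding cores_iff is_arg_min_def by (auto simp: not_less)
  then show ?thesis by blast
qed

text \<open>The conditional law of the core given the past is a measurable function of the current
configuration alone. This is what makes independence pass from the configuration to its core.
The empty configuration has no core, and its value is fixed to \<open>0\<close> since \<open>pmf_of_set {}\<close> is
unspecified.\<close>

lemma measurable_uniform_core:
  assumes [measurable]: "A \<in> sets config_space"
  shows "(\<lambda>X. if X = {#} then 0 else measure_pmf.prob (pmf_of_set (cores X)) A) \<in> borel_measurable config_space"
proof -
  define P where "P = (\<lambda>k i X. \<forall>j<k. config_G (drop_point i X) \<le> config_G (drop_point j X))"
  define num where "num A' k X = (\<Sum>i<k. if (P k i X \<and> drop_point i X \<in> A') \<and>
      (\<forall>j<i. P k j X \<and> drop_point j X \<in> A' \<longrightarrow> nth_point j X \<noteq> nth_point i X) then 1 else 0 :: real)"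
    for A' k X
  have [measurable]: "Measurable.pred config_space (P k i)" for k i
    unfolding P_def by measurable
  have num [measurable]: "num A' k \<in> borel_measurable config_space"
    if [measurable]: "A' \<in> sets config_space" for A' k
    unfolding num_def by measurable
  have card: "real (card (cores X \<inter> A')) = num A' (size X) X" for X A'
  proof -
    have "cores X \<inter> A' = (\<lambda>i. drop_point i X) ` {i. i < size X \<and> P (size X) i X \<and> drop_point i X \<in> A'}"
      by (auto simp: cores_nth_point P_def)
    moreover have "drop_point j X = drop_point i X \<longleftrightarrow> nth_point j X = nth_point i X"
      if "j < i" "i < size X" for i j
    proof -
      have "nth_point i X \<in># X" "nth_point j X \<in># X"
        using that by (auto intro: nth_point_in)
      moreover have "X - {#a#} = X - {#b#} \<longleftrightarrow> a = b" if "a \<in># X" "b \<in># X" for a b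
        using that by (metis insert_DiffM add_mset_add_single add_left_cancel single_eq_single)
      ultimately show ?thesis using that by (simp add: drop_point_def)
    qed
    ultimately show ?thesis
      unfolding num_def by (simp only: card_image_eq_sum_first) (intro sum.cong refl if_cong, auto)
  qed
  have "(if X = {#} then 0 else measure_pmf.prob (pmf_of_set (cores X)) A)
      = (if size X = 0 then 0 else num A (size X) X / num UNIV (size X) X)" for X
  proof (cases "X = {#}")
    case False
    then have "measure_pmf.prob (pmf_of_set (cores X)) A
        = real (card (cores X \<inter> A)) / real (card (cores X \<inter> UNIV))"
      using cores_nonempty[of X] by (simp add: measure_pmf_of_set)
    also have "\<dots> = num A (size X) X / num UNIV (size X) X"
      unfolding card ..
    finally show ?thesis using False by simp
  qed simp
  moreover have "(\<lambda>X. if size X = 0 then 0 else num A (size X) X / num UNIV (size X) X)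
      \<in> borel_measurable config_space"
  proof (rule measurable_compose_countable
          [where f = "\<lambda>k X. if k = 0 then 0 else num A k X / num UNIV k X"])
    have "UNIV \<in> sets config_space" using sets.top[of config_space] by simp
    then show "(\<lambda>X. if k = 0 then 0 else num A k X / num UNIV k X) \<in> borel_measurable config_space" for k
      using num[of A k] num[of UNIV k] by (cases "k = 0") simp_all
  qed measurable
  ultimately show ?thesis by (simp only:)
qed

section \<open>Exchanging one point of a configuration\<close>

lemma sum_mset_nonneg_real:
  fixes f :: "'c \<Rightarrow> real"
  assumes "\<And>x. x \<in># Y \<Longrightarrow> 0 \<le> f x"
  shows "0 \<le> (\<Sum>x\<in>#Y. f x)"
  using assms by (induction Y) auto

lemma sum_mset_strict_mono_real:
  fixes f g :: "'c \<Rightarrow> real"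
  assumes "Y \<noteq> {#}" and "\<And>x. x \<in># Y \<Longrightarrow> f x < g x"
  shows "(\<Sum>x\<in>#Y. f x) < (\<Sum>x\<in>#Y. g x)"
  using assms
proof (induction Y)
  case (add x Y)
  then show ?case by (cases "Y = {#}") (auto intro!: add_strict_mono)
qed simp

lemma sum_mset_sq_shift:
  fixes Y :: "real multiset"
  shows "(\<Sum>y\<in>#Y. (y - c)^2) = (\<Sum>y\<in>#Y. y^2) - 2 * c * sum_mset Y + real (size Y) * c^2"
  by (induction Y) (auto simp: power2_eq_square algebra_simps)

lemma config_G_alt:
  assumes "Y \<noteq> {#}"
  shows "config_G Y = (\<Sum>y\<in>#Y. (y - c)^2) - (sum_mset Y - real (size Y) * c)^2 / real (size Y)"
proof -
  have "real (size Y) > 0" using assms by (simp add: nonempty_has_size)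
  then show ?thesis
    unfolding config_G_def config_mean_def power2_abs sum_mset_sq_shift
    by (simp add: field_simps power2_eq_square)
qed

lemma config_G_nonneg: "0 \<le> config_G Y"
  unfolding config_G_def by (rule sum_mset_nonneg_real) auto

text \<open>Computed around the old mean \<open>m\<close>, the sum of squares changes by \<open>(z - m)^2 - (x - m)^2\<close>; the
last term corrects for the shift \<open>(z - x) / n\<close> of the mean.\<close>

lemma config_G_exchange:
  assumes x: "x \<in># Y"
  shows "config_G (add_mset z Y - {#x#}) = config_G Y - (x - config_mean Y)^2
    + (z - config_mean Y)^2 - (z - x)^2 / real (size Y)"
proof -
  obtain R where Y: "Y = add_mset x R" using x mset_add by metis
  let ?m = "config_mean Y"
  have s: "sum_mset Y = real (size Y) * ?m" by (simp add: config_mean_def Y)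
  have eq: "add_mset z Y - {#x#} = add_mset z R" by (simp add: Y)
  have "sum_mset (add_mset z R) - real (size (add_mset z R)) * ?m = z - x"
    using s by (simp add: Y)
  then have "config_G (add_mset z R) = (\<Sum>y\<in>#add_mset z R. (y - ?m)^2) - (z - x)^2 / real (size Y)"
    by (subst config_G_alt[of _ ?m]) (simp_all only: size_add_mset Y, simp_all)
  moreover have "config_G Y = (\<Sum>y\<in>#Y. (y - ?m)^2)"
    by (simp add: config_G_def)
  ultimately show ?thesis by (simp add: eq) (simp add: Y)
qed

lemma deviation_le_config_G:
  assumes "x \<in># Y"
  shows "(x - config_mean Y)^2 \<le> config_G Y"
proof -
  obtain R where Y: "Y = add_mset x R" using assms mset_add by metis
  have "0 \<le> (\<Sum>v\<in>#R. \<bar>v - config_mean Y\<bar>^2)" by (rule sum_mset_nonneg_real) auto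
  moreover have "config_G Y = (x - config_mean Y)^2 + (\<Sum>v\<in>#R. \<bar>v - config_mean Y\<bar>^2)"
    unfolding config_G_def by (subst (2) Y) simp
  ultimately show ?thesis by linarith
qed

lemma config_G_diff_le:
  assumes "x \<in># Y" "y \<in># Y"
  shows "(x - y)^2 \<le> 2 * config_G Y"
proof (cases "x = y")
  case False
  obtain R where R: "Y = add_mset x R" using assms mset_add by metis
  with assms False obtain S where Y: "Y = add_mset x (add_mset y S)"
    by (metis insert_noteq_member mset_add)
  let ?m = "config_mean Y"
  have "0 \<le> (\<Sum>v\<in>#S. \<bar>v - ?m\<bar>^2)" by (rule sum_mset_nonneg_real) auto
  moreover have "config_G Y = (x - ?m)^2 + (y - ?m)^2 + (\<Sum>v\<in>#S. \<bar>v - ?m\<bar>^2)"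
    unfolding config_G_def by (subst (2) Y) simp
  ultimately have "(x - ?m)^2 + (y - ?m)^2 \<le> config_G Y" by simp
  then have "2 * ((x - ?m)^2 + (y - ?m)^2) \<le> 2 * config_G Y" by (rule mult_left_mono) simp
  moreover have "(x - y)^2 \<le> 2 * ((x - ?m)^2 + (y - ?m)^2)"
    using zero_le_power2[of "(x - ?m) + (y - ?m)"] by (simp add: power2_eq_square algebra_simps)
  ultimately show ?thesis by (rule order_trans[rotated])
qed (simp add: config_G_nonneg)

lemma config_diff_le:
  assumes "x \<in># Y" "y \<in># Y"
  shows "\<bar>x - y\<bar> \<le> sqrt 2 * sqrt (config_G Y)"
proof -
  have "\<bar>x - y\<bar> = sqrt ((x - y)^2)" by simp
  also have "\<dots> \<le> sqrt (2 * config_G Y)" using config_G_diff_le[OF assms] by (rule real_sqrt_le_mono)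
  finally show ?thesis by (simp add: real_sqrt_mult)
qed

lemma config_G_far_point:
  assumes "Y \<noteq> {#}"
  shows "\<exists>x\<in>#Y. config_G Y / real (size Y) \<le> (x - config_mean Y)^2"
proof (rule ccontr)
  assume "\<not> ?thesis"
  then have "(\<Sum>x\<in>#Y. (x - config_mean Y)^2) < (\<Sum>x\<in>#Y. config_G Y / real (size Y))"
    using assms by (intro sum_mset_strict_mono_real) auto
  then show False using assms by (simp add: config_G_def)
qed

text \<open>The deviations from the mean add up to zero, so they cannot all have the sign of the deviation
of \<open>z\<close>.\<close>

lemma config_opposite_point:
  assumes "z \<in># Y"
  shows "\<exists>x\<in>#Y. (x - config_mean Y) * (z - config_mean Y) \<le> 0"
proof (rule ccontr)
  assume *: "\<not> ?thesis"
  let ?m = "config_mean Y"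
  have "(\<Sum>x\<in>#Y. 0) < (\<Sum>x\<in>#Y. (x - ?m) * (z - ?m))"
    using assms * by (intro sum_mset_strict_mono_real) auto
  also have "(\<Sum>x\<in>#Y. (x - ?m) * (z - ?m)) = (sum_mset Y - real (size Y) * ?m) * (z - ?m)"
  proof -
    have "(\<Sum>x\<in>#Y. (x - m) * (z - m)) = (sum_mset Y - real (size Y) * m) * (z - m)" for m
      by (induction Y) (auto simp: algebra_simps)
    then show ?thesis .
  qed
  also have "\<dots> = 0" using assms by (auto simp: config_mean_def)
  finally show False by simp
qed

text \<open>The constants \<open>contraction\<close> and \<open>contraction_radius\<close> are chosen for
\<open>near_central_point_contracting\<close>: an exact copy of the most central point lowers \<open>config_G\<close>
by a fraction of at least \<open>1 / (2 * n^2)\<close>, and the radius is so small that replacing the copy by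
a nearby point costs at most half of this gain. The proof uses that both depend on \<open>n\<close> alone.\<close>

definition contraction :: "nat \<Rightarrow> real" where
  "contraction n = 1 - 1 / (4 * (real n)^2)"

definition contraction_radius :: "nat \<Rightarrow> real" where
  "contraction_radius n = 1 / (28 * (real n)^2)"

text \<open>The samples that some exchange turns into an improvement of \<open>config_G\<close> by the factor
\<open>contraction n\<close>; as the next core is a minimizer, it improves at least as much.\<close>

definition contracting :: "nat \<Rightarrow> real multiset \<Rightarrow> real set" where
  "contracting n Y = {z. \<exists>x\<in>#Y. config_G (add_mset z Y - {#x#}) \<le> contraction n * config_G Y}"

text \<open>Let \<open>z0\<close> be a point of \<open>Y\<close> nearest to the mean \<open>m\<close>, at distance \<open>b\<close>, and suppose the new point
is a copy of \<open>z0\<close>. If \<open>b\<close> is small, it can replace a point whose squared deviation is at least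
the average \<open>F / n\<close>. If \<open>b\<close> is not small, it replaces a point on the other side of \<open>m\<close>: that
point is at least as far from \<open>m\<close> as \<open>z0\<close>, so the two are at least \<open>2 * b\<close> apart and the
shift of the mean alone gives the gain. Moving the copy by \<open>e\<close> changes the estimates by at most a few multiples of \<open>contraction_radius n * F\<close>.\<close>

lemma near_central_point_contracting:
  assumes n: "size Y = n" "0 < n"
  shows "\<exists>z0\<in>#Y. \<forall>z. \<bar>z - z0\<bar> \<le> contraction_radius n * sqrt (config_G Y) \<longrightarrow> z \<in> contracting n Y"
proof -
  let ?m = "config_mean Y" and ?F = "config_G Y" and ?s = "sqrt (config_G Y)"
  let ?\<eta> = "contraction_radius n"
  have ne: "Y \<noteq> {#}" using n by auto
  have F: "0 \<le> ?F" by (rule config_G_nonneg)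
  have s2: "?s * ?s = ?F" and s0: "0 \<le> ?s" using F by simp_all
  have n1: "1 \<le> real n" using n by simp
  have nn: "1 / (real n)^2 \<le> 1 / real n"
    using n1 by (simp add: field_simps power2_eq_square)
  have nn1: "1 / (real n)^2 \<le> 1" using n1 by (simp add: field_simps)
  have \<eta>: "28 * ?\<eta> = 1 / (real n)^2" "0 \<le> ?\<eta>" by (simp_all add: contraction_radius_def)
  then have \<eta>1: "?\<eta> \<le> 1" using nn1 by linarith
  obtain z0 where z0: "z0 \<in># Y" and near: "\<And>x. x \<in># Y \<Longrightarrow> \<bar>z0 - ?m\<bar> \<le> \<bar>x - ?m\<bar>"
    using ex_is_arg_min_if_finite[of "set_mset Y" "\<lambda>x. \<bar>x - ?m\<bar>"] ne
    by (auto simp: is_arg_min_linorder)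
  let ?b = "z0 - ?m"
  have bF: "?b^2 \<le> ?F" using z0 by (rule deviation_le_config_G)
  then have bs: "\<bar>?b\<bar> \<le> ?s" by (metis real_sqrt_abs real_sqrt_le_iff)
  have "z \<in> contracting n Y" if z: "\<bar>z - z0\<bar> \<le> ?\<eta> * ?s" for z
  proof -
    define e where "e = z - z0"
    have e: "\<bar>e\<bar> \<le> ?\<eta> * ?s" using z by (simp add: e_def)
    have e2: "e^2 \<le> ?\<eta> * ?F"
    proof -
      have "e^2 = \<bar>e\<bar> * \<bar>e\<bar>" by (simp add: power2_eq_square)
      also have "\<dots> \<le> (?\<eta> * ?s) * (1 * ?s)"
        using e mult_right_mono[OF \<eta>1 s0] \<eta>(2) s0 by (intro mult_mono) auto
      also have "\<dots> = ?\<eta> * ?F" using s2 by (simp add: algebra_simps)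
      finally show ?thesis .
    qed
    have "\<bar>?b * e\<bar> \<le> ?s * (?\<eta> * ?s)"
      unfolding abs_mult using bs e s0 by (intro mult_mono) auto
    then have be: "\<bar>?b * e\<bar> \<le> ?\<eta> * ?F" using s2 by (simp add: algebra_simps)
    have "(z - ?m)^2 = ?b^2 + 2 * (?b * e) + e^2"
      by (simp add: e_def power2_eq_square algebra_simps)
    then have zm: "(z - ?m)^2 \<le> ?b^2 + 3 * (?\<eta> * ?F)"
      using be e2 by linarith
    have \<eta>F: "28 * (?\<eta> * ?F) = ?F / (real n)^2"
      using \<eta>(1) by (simp add: mult.assoc[symmetric])
    have goal: "contraction n * ?F = ?F - 7 * (?\<eta> * ?F)"
      unfolding contraction_def using \<eta>F by (simp add: algebra_simps)
    show ?thesis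
    proof (cases "?b^2 \<le> (?F / real n) / 2")
      case True
      define p where "p = ?F / real n"
      obtain x where x: "x \<in># Y" "?F / real (size Y) \<le> (x - ?m)^2"
        using config_G_far_point[OF ne] by blast
      have "config_G (add_mset z Y - {#x#}) \<le> ?F - p + p / 2 + 3 * (?\<eta> * ?F)"
      proof -
        have "0 \<le> (z - x)^2 / real n" by simp
        then show ?thesis
          unfolding config_G_exchange[OF x(1)] n(1)
          using x(2)[unfolded n(1), folded p_def] zm True[folded p_def] by linarith
      qed
      moreover have "28 * (?\<eta> * ?F) \<le> p"
        unfolding \<eta>F p_def using mult_left_mono[OF nn F] by simp
      ultimately have "config_G (add_mset z Y - {#x#}) \<le> ?F - 7 * (?\<eta> * ?F)"
        using mult_nonneg_nonneg[OF \<eta>(2) F] by linarith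
      then show ?thesis unfolding contracting_def goal using x(1) by auto
    next
      case False
      obtain x where x: "x \<in># Y" "(x - ?m) * ?b \<le> 0"
        using config_opposite_point[OF z0] by blast
      define a where "a = x - ?m"
      have ab: "\<bar>?b\<bar> \<le> \<bar>a\<bar>" using near[OF x(1)] by (simp add: a_def)
      have ab2: "?b^2 \<le> a^2" using ab by (simp add: abs_le_square_iff)
      have "a^2 \<le> ?F" unfolding a_def using x(1) by (rule deviation_le_config_G)
      then have aF: "\<bar>a\<bar> \<le> ?s" by (metis real_sqrt_abs real_sqrt_le_iff)
      have "\<bar>a * e\<bar> \<le> ?s * (?\<eta> * ?s)"
        unfolding abs_mult using aF e s0 by (intro mult_mono) auto
      then have ae: "\<bar>a * e\<bar> \<le> ?\<eta> * ?F" using s2 by (simp add: algebra_simps)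
      have "(z - x)^2 = (?b^2 + a^2 - 2 * (a * ?b)) + 2 * (?b * e) - 2 * (a * e) + e^2"
        by (simp add: e_def a_def power2_eq_square algebra_simps)
      moreover have "a * ?b \<le> 0" using x(2) by (simp add: a_def)
      ultimately have zx: "(z - x)^2 \<ge> 2 * ?b^2 - 4 * (?\<eta> * ?F)"
        using be ae ab2 zero_le_power2[of e] by linarith
      have "2 * ?b^2 / real n \<ge> ?F / (real n)^2"
      proof -
        have "(?F / real n) / 2 * (2 / real n) \<le> ?b^2 * (2 / real n)"
          using False by (intro mult_right_mono) auto
        then show ?thesis by (simp add: power2_eq_square mult.commute)
      qed
      moreover have "4 * (?\<eta> * ?F) / real n \<le> 4 * (?\<eta> * ?F)"
      proof -
        have "4 * (?\<eta> * ?F) / real n \<le> 4 * (?\<eta> * ?F) / 1"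
          using n1 mult_nonneg_nonneg[OF \<eta>(2) F] by (intro divide_left_mono) auto
        then show ?thesis by simp
      qed
      moreover have "(z - x)^2 / real n \<ge> 2 * ?b^2 / real n - 4 * (?\<eta> * ?F) / real n"
        using divide_right_mono[OF zx, of "real n"] n1 by (simp add: diff_divide_distrib)
      ultimately have "(z - x)^2 / real n \<ge> 24 * (?\<eta> * ?F)"
        using \<eta>F by linarith
      then have "config_G (add_mset z Y - {#x#}) \<le> ?F - 7 * (?\<eta> * ?F)"
        unfolding config_G_exchange[OF x(1)] n(1) a_def[symmetric]
        using zm ab2 mult_nonneg_nonneg[OF \<eta>(2) F] by linarith
      then show ?thesis unfolding contracting_def goal using x(1) by auto
    qed
  qed
  with z0 show ?thesis by blast
qed

section \<open>One step of the process\<close>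

lemma cores_size: "Y' \<in> cores X \<Longrightarrow> Suc (size Y') = size X"
  by (simp add: cores_def is_arg_min_def)

text \<open>Discarding the new point is always one of the candidates.\<close>

lemma cores_add_G_le:
  assumes "Y' \<in> cores (add_mset z Y)"
  shows "config_G Y' \<le> config_G Y"
proof -
  have "config_G Y' \<le> config_G (add_mset z Y - {#z#})"
    using assms unfolding cores_iff by (elim conjE) (rule bspec, auto)
  then show ?thesis by simp
qed

lemma cores_add_contracting:
  assumes "Y' \<in> cores (add_mset z Y)" "z \<in> contracting n Y"
  shows "config_G Y' \<le> contraction n * config_G Y"
proof -
  obtain x where x: "x \<in># Y" "config_G (add_mset z Y - {#x#}) \<le> contraction n * config_G Y"
    using assms(2) unfolding contracting_def by blast
  have "config_G Y' \<le> config_G (add_mset z Y - {#x#})"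
    using assms(1) x(1) unfolding cores_iff by (elim conjE) (rule bspec, auto)
  with x(2) show ?thesis by linarith
qed

text \<open>The two cores differ in at most one point, so they meet if there are at least two points; this is
what keeps the process from jumping.\<close>

lemma cores_add_shared_point:
  assumes "Y' \<in> cores (add_mset z Y)" "2 \<le> size Y"
  shows "\<exists>y. y \<in># Y \<and> y \<in># Y'"
proof -
  obtain x where x: "x \<in># add_mset z Y" "Y' = add_mset z Y - {#x#}"
    using assms(1) unfolding cores_iff by blast
  show ?thesis
  proof (cases "x \<in># Y")
    case True
    then obtain R where R: "Y = add_mset x R" using mset_add by metis
    then have "R \<noteq> {#}" using assms(2) by auto
    then obtain y where "y \<in># R" by blast
    then show ?thesis using x(2) R by auto
  next
    case False
    then have "Y' = Y" using x by auto
    moreover have "Y \<noteq> {#}" using assms(2) by auto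
    ultimately show ?thesis by (metis multiset_nonemptyE)
  qed
qed

lemma cores_add_subset:
  assumes "Y' \<in> cores (add_mset z Y)"
  shows "set_mset Y' \<subseteq> insert z (set_mset Y)"
  using assms unfolding cores_iff by (auto dest: in_diffD)

text \<open>A new maximum is the sample itself. It is tied to the old core by a common point, and the
diameter of the new core is bounded through its \<open>config_G\<close>, which is at most the old one.\<close>

lemma Max_increase:
  assumes c: "Y' \<in> cores (add_mset z Y)" "2 \<le> size Y"
    and inc: "Max (set_mset Y) < Max (set_mset Y')"
  shows "z = Max (set_mset Y')" "z \<le> Max (set_mset Y) + sqrt 2 * sqrt (config_G Y)"
proof -
  have "Suc (size Y') = Suc (size Y)" using cores_size[OF c(1)] by simp
  then have ne: "set_mset Y' \<noteq> {}" using c(2) by auto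
  then have in': "Max (set_mset Y') \<in># Y'" by simp
  then have "Max (set_mset Y') \<in> insert z (set_mset Y)" using cores_add_subset[OF c(1)] by blast
  moreover have "Max (set_mset Y') \<notin># Y" using inc by (metis Max_ge finite_set_mset not_le)
  ultimately show z: "z = Max (set_mset Y')" by simp
  obtain y where y: "y \<in># Y" "y \<in># Y'" using cores_add_shared_point[OF c] by blast
  have "\<bar>z - y\<bar> \<le> sqrt 2 * sqrt (config_G Y')" unfolding z using in' y(2) by (rule config_diff_le)
  also have "\<dots> \<le> sqrt 2 * sqrt (config_G Y)" using cores_add_G_le[OF c(1)] by simp
  finally show "z \<le> Max (set_mset Y) + sqrt 2 * sqrt (config_G Y)"
    using Max_ge[OF finite_set_mset y(1)] by linarith
qed

lemma Min_decrease:
  assumes c: "Y' \<in> cores (add_mset z Y)" "2 \<le> size Y"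
    and inc: "Min (set_mset Y') < Min (set_mset Y)"
  shows "z = Min (set_mset Y')" "Min (set_mset Y) - sqrt 2 * sqrt (config_G Y) \<le> z"
proof -
  have "Suc (size Y') = Suc (size Y)" using cores_size[OF c(1)] by simp
  then have ne: "set_mset Y' \<noteq> {}" using c(2) by auto
  then have in': "Min (set_mset Y') \<in># Y'" by simp
  then have "Min (set_mset Y') \<in> insert z (set_mset Y)" using cores_add_subset[OF c(1)] by blast
  moreover have "Min (set_mset Y') \<notin># Y" using inc by (metis Min_le finite_set_mset not_le)
  ultimately show z: "z = Min (set_mset Y')" by simp
  obtain y where y: "y \<in># Y" "y \<in># Y'" using cores_add_shared_point[OF c] by blast
  have "\<bar>z - y\<bar> \<le> sqrt 2 * sqrt (config_G Y')" unfolding z using in' y(2) by (rule config_diff_le)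
  also have "\<dots> \<le> sqrt 2 * sqrt (config_G Y)" using cores_add_G_le[OF c(1)] by simp
  finally show "Min (set_mset Y) - sqrt 2 * sqrt (config_G Y) \<le> z"
    using Min_le[OF finite_set_mset y(1)] by linarith
qed

section \<open>Mass estimates for the law of the samples\<close>

lemma bex_iff_nth_point: "(\<exists>x\<in>#Y. P x) \<longleftrightarrow> (\<exists>i<size Y. P (nth_point i Y))"
  using in_multiset_iff_nth_point[of _ Y] by metis

lemma contracting_section:
  assumes "size Y = n"
  shows "z \<in> contracting n Y \<longleftrightarrow>
    (\<exists>i<n. config_G Y - (nth_point i Y - config_mean Y)^2 + (z - config_mean Y)^2
        - (z - nth_point i Y)^2 / real n \<le> contraction n * config_G Y)"
proof -
  have "z \<in> contracting n Y \<longleftrightarrow> (\<exists>x\<in>#Y. config_G Y - (x - config_mean Y)^2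
      + (z - config_mean Y)^2 - (z - x)^2 / real n \<le> contraction n * config_G Y)"
    unfolding contracting_def using config_G_exchange[of _ Y z] assms by auto
  then show ?thesis unfolding bex_iff_nth_point assms .
qed

lemma measurable_contracting [measurable]:
  "{p \<in> space (config_space \<Otimes>\<^sub>M borel). size (fst p) = n \<and> snd p \<in> contracting n (fst p)}
    \<in> sets (config_space \<Otimes>\<^sub>M borel)"
proof -
  have "{p \<in> space (config_space \<Otimes>\<^sub>M borel). size (fst p) = n \<and> snd p \<in> contracting n (fst p)} =
    {p \<in> space (config_space \<Otimes>\<^sub>M borel). size (fst p) = n \<and>
      (\<exists>i<n. config_G (fst p) - (nth_point i (fst p) - config_mean (fst p))^2
        + (snd p - config_mean (fst p))^2 - (snd p - nth_point i (fst p))^2 / real n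
        \<le> contraction n * config_G (fst p))}"
    using contracting_section by auto
  also have "\<dots> \<in> sets (config_space \<Otimes>\<^sub>M borel)"
    by measurable
  finally show ?thesis .
qed

lemma contracting_borel:
  assumes "size Y = n"
  shows "contracting n Y \<in> sets borel"
proof -
  have "contracting n Y = {z \<in> space borel.
    \<exists>i<n. config_G Y - (nth_point i Y - config_mean Y)^2 + (z - config_mean Y)^2
        - (z - nth_point i Y)^2 / real n \<le> contraction n * config_G Y}"
    using contracting_section[OF assms] by auto
  also have "\<dots> \<in> sets borel" by measurable
  finally show ?thesis .
qed

text \<open>Iterated doubling: each interval of a chain carries at most \<open>C\<close> times the mass of its predecessor,
so a set covered by finitely many of them is controlled by the first one.\<close>

lemma (in finite_measure) measure_chain_le:
  assumes I: "\<And>j. I j \<in> sets M" and "0 \<le> C"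
    and chain: "\<And>j. measure M (I (Suc j)) \<le> C * measure M (I j)"
    and V: "V \<subseteq> (\<Union>j<J. I j)" and W: "I 0 \<subseteq> W" "W \<in> sets M"
  shows "measure M V \<le> (\<Sum>j<J. C ^ j) * measure M W"
proof -
  have *: "measure M (I j) \<le> C ^ j * measure M W" for j
  proof (induction j)
    case 0
    show ?case using finite_measure_mono[OF W] by simp
  next
    case (Suc j)
    have "measure M (I (Suc j)) \<le> C * measure M (I j)" by (rule chain)
    also have "\<dots> \<le> C * (C ^ j * measure M W)"
      using Suc \<open>0 \<le> C\<close> by (rule mult_left_mono)
    finally show ?case by (simp add: mult.assoc)
  qed
  have "measure M V \<le> measure M (\<Union>j<J. I j)"
    using I V by (intro finite_measure_mono) auto
  also have "\<dots> \<le> (\<Sum>j<J. measure M (I j))"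
    using I by (intro finite_measure_subadditive_finite) auto
  also have "\<dots> \<le> (\<Sum>j<J. C ^ j * measure M W)"
    by (rule sum_mono) (rule *)
  finally show ?thesis by (simp add: sum_distrib_right)
qed

text \<open>The number of intervals of length \<open>contraction_radius n * s\<close> that cover a distance \<open>3 * s\<close>,
with one to spare to have a strict inequality.\<close>

definition chain_length :: "nat \<Rightarrow> nat" where
  "chain_length n = 84 * n^2 + 1"

lemma chain_length_radius:
  assumes "0 < n"
  shows "3 < real (chain_length n) * contraction_radius n"
proof -
  have "real (chain_length n) * contraction_radius n = 3 + contraction_radius n"
    using assms by (simp add: chain_length_def contraction_radius_def field_simps)
  moreover have "0 < contraction_radius n" using assms by (simp add: contraction_radius_def)
  ultimately show ?thesis by simp
qed

lemma sqrt2_le: "2 * sqrt 2 \<le> (3::real)"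
  using real_le_lsqrt[of "3/2" 2] by (simp add: power2_eq_square)

lemma floor_index:
  fixes d u :: real
  assumes "0 < d" "0 < u" "d \<le> real J * u"
  shows "\<exists>j<J. real j * u < d \<and> d \<le> real (Suc j) * u"
proof -
  have ex: "\<exists>k. d \<le> real k * u" using assms by blast
  define k where "k = (LEAST k. d \<le> real k * u)"
  have k: "d \<le> real k * u" unfolding k_def by (rule LeastI_ex[OF ex])
  have "k \<le> J" unfolding k_def using assms by (intro Least_le)
  have "k \<noteq> 0" using k assms by (cases k) auto
  then obtain j where j: "k = Suc j" by (cases k) auto
  have "\<not> d \<le> real j * u" unfolding k_def using j not_less_Least[of j "\<lambda>k. d \<le> real k * u"]
    by (simp add: k_def)
  with k j \<open>k \<le> J\<close> show ?thesis by (intro exI[of _ j]) auto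
qed

lemma central_point_scale:
  assumes n: "size Y = n" "2 \<le> n" and F: "config_G Y \<noteq> 0"
  obtains z0 u where "z0 \<in># Y" "0 < u"
    "(2 * sqrt 2) * sqrt (config_G Y) < real (chain_length n) * u"
    "\<And>z. \<bar>z - z0\<bar> \<le> u \<Longrightarrow> z \<in> contracting n Y"
proof -
  let ?s = "sqrt (config_G Y)"
  have s: "0 < ?s" using F config_G_nonneg[of Y] by simp
  obtain z0 where z0: "z0 \<in># Y"
    and near: "\<And>z. \<bar>z - z0\<bar> \<le> contraction_radius n * ?s \<Longrightarrow> z \<in> contracting n Y"
    using near_central_point_contracting[OF n(1)] n(2) by auto
  have "0 < contraction_radius n * ?s" using s n by (simp add: contraction_radius_def)
  moreover have "(2 * sqrt 2) * ?s < real (chain_length n) * (contraction_radius n * ?s)"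
  proof -
    have "2 * sqrt 2 < real (chain_length n) * contraction_radius n"
      using sqrt2_le chain_length_radius[of n] n by simp
    from mult_strict_right_mono[OF this s] show ?thesis by (simp add: mult.assoc)
  qed
  ultimately show thesis using that z0 near by blast
qed

text \<open>The key comparison. An outward jump of the right end point needs a sample in an interval of length
proportional to \<open>s = sqrt (config_G Y)\<close>. Starting from the most central point \<open>z0\<close>, which is at
most \<open>sqrt 2 * s\<close> to the left of the maximum, a fixed number of doubling steps of length
\<open>u\<close> reaches the end of this interval, and the first step lies among the contracting samples. Since
\<open>z0 \<ge> R\<close>, the doubling hypothesis is available throughout. If \<open>config_G Y = 0\<close>, the interval is
empty.\<close>

lemma right_jump_mass:
  fixes Q :: "real measure"
  assumes fin: "finite_measure Q" and Q: "sets Q = sets borel" and n: "size Y = n" "2 \<le> n" and C: "0 \<le> C"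
    and doubling: "\<And>a u. R \<le> a \<Longrightarrow> 0 < u \<Longrightarrow>
      measure Q {a + u<..a + 2 * u} \<le> C * measure Q {a<..a + u}"
    and R: "R \<le> Min (set_mset Y)"
  shows "measure Q {Max (set_mset Y)<..Max (set_mset Y) + sqrt 2 * sqrt (config_G Y)}
    \<le> (\<Sum>j<chain_length n. C ^ j) * measure Q (contracting n Y)"
proof (cases "config_G Y = 0")
  case True
  then show ?thesis using C by (simp add: sum_nonneg)
next
  case False
  interpret finite_measure Q by (rule fin)
  let ?s = "sqrt (config_G Y)" and ?J = "chain_length n"
  obtain z0 u where z0: "z0 \<in># Y" and u: "0 < u" "(2 * sqrt 2) * ?s < real ?J * u"
    and near: "\<And>z. \<bar>z - z0\<bar> \<le> u \<Longrightarrow> z \<in> contracting n Y"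
    by (rule central_point_scale[OF n False]) blast
  define I where "I j = {z0 + real j * u<..z0 + real (Suc j) * u}" for j
  have Rz: "R \<le> z0" using R Min_le[OF finite_set_mset z0] by linarith
  show ?thesis
  proof (rule measure_chain_le[where I = I])
    show "measure Q (I (Suc j)) \<le> C * measure Q (I j)" for j
    proof -
      have "R \<le> z0 + real j * u" using Rz u by (simp add: add_increasing2)
      from doubling[OF this u(1)] show ?thesis by (simp add: I_def algebra_simps)
    qed
    show "{Max (set_mset Y)<..Max (set_mset Y) + sqrt 2 * ?s} \<subseteq> (\<Union>j<?J. I j)"
    proof
      fix z assume z: "z \<in> {Max (set_mset Y)<..Max (set_mset Y) + sqrt 2 * ?s}"
      have top: "Max (set_mset Y) \<in># Y" using z0 by (intro Max_in) auto
      have "z0 \<le> Max (set_mset Y)" using z0 by simp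
      moreover have "Max (set_mset Y) - z0 \<le> sqrt 2 * ?s"
        using config_diff_le[OF top z0] by linarith
      ultimately have "0 < z - z0" "z - z0 \<le> real ?J * u" using z u(2) by auto
      from floor_index[OF this(1) u(1) this(2)] obtain j where
        "j < ?J" "real j * u < z - z0" "z - z0 \<le> real (Suc j) * u" by blast
      then have "j \<in> {..<?J}" "z \<in> I j" by (auto simp: I_def)
      then show "z \<in> (\<Union>j<?J. I j)" by blast
    qed
    show "I 0 \<subseteq> contracting n Y" using near by (auto simp: I_def)
  qed (use C Q contracting_borel[OF n(1)] in \<open>auto simp: I_def\<close>)
qed

lemma left_jump_mass:
  fixes Q :: "real measure"
  assumes fin: "finite_measure Q" and Q: "sets Q = sets borel" and n: "size Y = n" "2 \<le> n" and C: "0 \<le> C"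
    and doubling: "\<And>a u. a \<le> R \<Longrightarrow> u < 0 \<Longrightarrow>
      measure Q {a + 2 * u<..a + u} \<le> C * measure Q {a + u<..a}"
    and R: "Max (set_mset Y) \<le> R"
  shows "measure Q {Min (set_mset Y) - sqrt 2 * sqrt (config_G Y)..<Min (set_mset Y)}
    \<le> (\<Sum>j<chain_length n. C ^ j) * measure Q (contracting n Y)"
proof (cases "config_G Y = 0")
  case True
  then show ?thesis using C by (simp add: sum_nonneg)
next
  case False
  interpret finite_measure Q by (rule fin)
  let ?s = "sqrt (config_G Y)" and ?J = "chain_length n"
  obtain z0 u where z0: "z0 \<in># Y" and u: "0 < u" "(2 * sqrt 2) * ?s < real ?J * u"
    and near: "\<And>z. \<bar>z - z0\<bar> \<le> u \<Longrightarrow> z \<in> contracting n Y"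
    by (rule central_point_scale[OF n False]) blast
  define I where "I j = {z0 - real (Suc j) * u<..z0 - real j * u}" for j
  have Rz: "z0 \<le> R" using R Max_ge[OF finite_set_mset z0] by linarith
  show ?thesis
  proof (rule measure_chain_le[where I = I])
    show "measure Q (I (Suc j)) \<le> C * measure Q (I j)" for j
    proof -
      have "0 \<le> real j * u" using u(1) by simp
      then have "z0 - real j * u \<le> R" using Rz by linarith
      from doubling[OF this, of "-u"] u(1) show ?thesis by (simp add: I_def algebra_simps)
    qed
    show "{Min (set_mset Y) - sqrt 2 * ?s..<Min (set_mset Y)} \<subseteq> (\<Union>j<?J. I j)"
    proof
      fix z assume z: "z \<in> {Min (set_mset Y) - sqrt 2 * ?s..<Min (set_mset Y)}"
      have bot: "Min (set_mset Y) \<in># Y" using z0 by (intro Min_in) auto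
      have "Min (set_mset Y) \<le> z0" using z0 by simp
      moreover have "z0 - Min (set_mset Y) \<le> sqrt 2 * ?s"
        using config_diff_le[OF bot z0] by linarith
      ultimately have "0 < z0 - z" "z0 - z < real ?J * u" using z u(2) by auto
      \<comment> \<open>The cells \<open>I j\<close> are closed on the right, so the index is counted from the far end
        \<open>z0 - J * u\<close>, where the half-open cells have the orientation of \<open>floor_index\<close>.\<close>
      then have d: "0 < real ?J * u - (z0 - z)" "real ?J * u - (z0 - z) \<le> real ?J * u" by auto
      from floor_index[OF d(1) u(1) d(2)] obtain i where i: "i < ?J"
        "real i * u < real ?J * u - (z0 - z)" "real ?J * u - (z0 - z) \<le> real (Suc i) * u" by blast
      define j where "j = ?J - Suc i"
      have "real ?J = real j + real i + 1" using i(1) by (simp add: j_def)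
      then have "z \<in> I j" using i(2,3) by (auto simp: I_def algebra_simps)
      moreover have "j < ?J" using i(1) by (simp add: j_def)
      ultimately show "z \<in> (\<Union>j<?J. I j)" by blast
    qed
    show "I 0 \<subseteq> contracting n Y" using near by (auto simp: I_def)
  qed (use C Q contracting_borel[OF n(1)] in \<open>auto simp: I_def\<close>)
qed

section \<open>The support of the law\<close>

lemma rv_supp_distr:
  assumes "\<zeta> \<in> borel_measurable D"
  shows "rv_supp D \<zeta> = {x. \<forall>\<epsilon>>0. 0 < measure (distr D borel \<zeta>) (ball x \<epsilon>)}"
proof -
  have "measure (distr D borel \<zeta>) (ball x \<epsilon>) = \<P>(\<omega> in D. \<bar>\<zeta> \<omega> - x\<bar> < \<epsilon>)" for x \<epsilon>
    using assms by (subst measure_distr)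
      (auto intro!: arg_cong[where f = "measure D"] simp: dist_real_def abs_minus_commute)
  then show ?thesis by (simp add: rv_supp_def)
qed

text \<open>The complement of the support is a union of open null balls, and countably many of them suffice.\<close>

lemma open_Compl_rv_supp:
  assumes D: "prob_space D" and \<zeta>: "\<zeta> \<in> borel_measurable D"
  shows "open (- rv_supp D \<zeta>)"
    and "- rv_supp D \<zeta> \<in> null_sets (distr D borel \<zeta>)"
proof -
  interpret Q: prob_space "distr D borel \<zeta>" using D \<zeta> by (rule prob_space.prob_space_distr)
  define \<F> where "\<F> = {ball x \<epsilon> | x \<epsilon>. 0 < \<epsilon> \<and> Q.prob (ball x \<epsilon>) = 0}"
  have "- rv_supp D \<zeta> = \<Union>\<F>"
  proof (intro equalityI subsetI)
    fix x assume "x \<in> - rv_supp D \<zeta>"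
    then obtain \<epsilon> where "0 < \<epsilon>" "Q.prob (ball x \<epsilon>) = 0"
      by (auto simp: rv_supp_distr[OF \<zeta>] zero_less_measure_iff)
    then show "x \<in> \<Union>\<F>" unfolding \<F>_def by (intro UnionI[of "ball x \<epsilon>"]) auto
  next
    fix y assume "y \<in> \<Union>\<F>"
    then obtain x \<epsilon> where y: "y \<in> ball x \<epsilon>" and 0: "Q.prob (ball x \<epsilon>) = 0" by (auto simp: \<F>_def)
    then obtain \<delta> where \<delta>: "0 < \<delta>" "ball y \<delta> \<subseteq> ball x \<epsilon>" using open_contains_ball open_ball by metis
    then have "Q.prob (ball y \<delta>) \<le> 0" using 0 Q.finite_measure_mono[of "ball y \<delta>" "ball x \<epsilon>"] by simp
    then show "y \<in> - rv_supp D \<zeta>" using \<delta>(1) by (auto simp: rv_supp_distr[OF \<zeta>] not_less)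
  qed
  moreover have op: "open S" if "S \<in> \<F>" for S using that by (auto simp: \<F>_def)
  ultimately show "open (- rv_supp D \<zeta>)" by auto
  obtain \<F>' where \<F>': "\<F>' \<subseteq> \<F>" "countable \<F>'" "\<Union>\<F>' = \<Union>\<F>" using Lindelof op by metis
  have "(\<Union>S\<in>\<F>'. S) \<in> null_sets (distr D borel \<zeta>)"
  proof (rule null_sets_UN'[OF \<F>'(2)])
    fix S assume "S \<in> \<F>'"
    then show "S \<in> null_sets (distr D borel \<zeta>)"
      using \<F>'(1) by (auto simp: \<F>_def null_sets_def Q.emeasure_eq_measure)
  qed
  then show "- rv_supp D \<zeta> \<in> null_sets (distr D borel \<zeta>)"
    using \<F>'(3) \<open>- rv_supp D \<zeta> = \<Union>\<F>\<close> by simp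
qed

text \<open>Each point of the support has positive mass near it; compactness makes the bound uniform.\<close>

lemma compact_supp_mass:
  assumes D: "prob_space D" and \<zeta>: "\<zeta> \<in> borel_measurable D"
    and K: "compact K" "K \<subseteq> rv_supp D \<zeta>" and r: "0 < r"
  shows "\<exists>p>0. \<forall>x\<in>K. p \<le> measure (distr D borel \<zeta>) (ball x r)"
proof -
  interpret Q: prob_space "distr D borel \<zeta>" using D \<zeta> by (rule prob_space.prob_space_distr)
  obtain E where E: "E \<subseteq> K" "finite E" "K \<subseteq> (\<Union>x\<in>E. ball x (r / 2))"
    using K(1) r by (elim compactE_image[of K K "\<lambda>x. ball x (r / 2)"]) auto
  define p where "p = Min (insert 1 ((\<lambda>x. Q.prob (ball x (r / 2))) ` E))"
  have "0 < p"
    unfolding p_def using E K(2) r by (auto simp: rv_supp_distr[OF \<zeta>])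
  moreover have "p \<le> Q.prob (ball x r)" if x: "x \<in> K" for x
  proof -
    obtain y where y: "y \<in> E" "x \<in> ball y (r / 2)" using E(3) x by blast
    have "p \<le> Q.prob (ball y (r / 2))" unfolding p_def using E(2) y(1) by (intro Min_le) auto
    also have "\<dots> \<le> Q.prob (ball x r)"
    proof (rule Q.finite_measure_mono)
      show "ball y (r / 2) \<subseteq> ball x r"
      proof
        fix v assume "v \<in> ball y (r / 2)"
        then show "v \<in> ball x r" using y(2) dist_triangle[of x v y] by (simp add: dist_commute)
      qed
    qed simp
    finally show ?thesis .
  qed
  ultimately show ?thesis by blast
qed

section \<open>Independence of the core from later samples\<close>

lemma Int_stable_vimage: "Int_stable {f -` A \<inter> \<Omega> | A. A \<in> sets N}"
proof (unfold Int_stable_def, safe)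
  fix A B assume "A \<in> sets N" "B \<in> sets N"
  then show "\<exists>C. f -` A \<inter> \<Omega> \<inter> (f -` B \<inter> \<Omega>) = f -` C \<inter> \<Omega> \<and> C \<in> sets N"
    by (intro exI[of _ "A \<inter> B"]) auto
qed

context jante_process
begin

lemma Z_measurable: "1 \<le> t \<Longrightarrow> Z t \<in> borel_measurable M"
  using Z_indep by (auto simp: indep_vars_def)

lemma size_process:
  assumes "\<omega> \<in> space M"
  shows "size (X t \<omega>) = N" "Suc (size (X' t \<omega>)) = N"
proof -
  show "size (X t \<omega>) = N"
  proof (induction t)
    case 0
    then show ?case using init[OF assms] by auto
  next
    case (Suc t)
    then show ?case using step[OF assms, of t] cores_size[OF core[OF assms, of t]] by simp
  qed
  then show "Suc (size (X' t \<omega>)) = N" using cores_size[OF core[OF assms, of t]] by simp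
qed

definition cylinder :: "nat set \<Rightarrow> (nat \<Rightarrow> real set) \<Rightarrow> 'a set" where
  "cylinder J B = {\<omega> \<in> space M. \<forall>s\<in>J. Z s \<omega> \<in> B s}"

text \<open>Independence of \<open>f\<close> from the samples at times \<open>T\<close> and later, expressed through finite-dimensional
events because these are what the induction step handles.\<close>

definition indep_from :: "('a \<Rightarrow> real multiset) \<Rightarrow> nat \<Rightarrow> bool" where
  "indep_from f T \<longleftrightarrow> (\<forall>A J B. A \<in> sets config_space \<and> finite J \<and> J \<subseteq> {T..} \<and> (\<forall>s. B s \<in> sets borel) \<longrightarrow>
    prob (f -` A \<inter> space M \<inter> cylinder J B) = prob (f -` A \<inter> space M) * prob (cylinder J B))"

lemma indep_fromD:
  assumes "indep_from f T" "A \<in> sets config_space" "finite J" "J \<subseteq> {T..}" "\<And>s. B s \<in> sets borel"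
  shows "prob (f -` A \<inter> space M \<inter> cylinder J B) = prob (f -` A \<inter> space M) * prob (cylinder J B)"
  using assms unfolding indep_from_def by blast

lemma cylinder_events:
  assumes "finite J" "J \<subseteq> {1..}" "\<And>s. B s \<in> sets borel"
  shows "cylinder J B \<in> events"
  unfolding cylinder_def
proof (rule sets.sets_Collect_finite_All[OF _ assms(1)])
  fix s assume "s \<in> J"
  then have "Z s -` B s \<inter> space M \<in> events" using assms by (intro measurable_sets[OF Z_measurable]) auto
  also have "Z s -` B s \<inter> space M = {\<omega> \<in> space M. Z s \<omega> \<in> B s}" by auto
  finally show "{\<omega> \<in> space M. Z s \<omega> \<in> B s} \<in> events" .
qed

lemma prob_cylinder:
  assumes "finite J" "J \<subseteq> {1..}" "\<And>s. B s \<in> sets borel"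
  shows "prob (cylinder J B) = (\<Prod>s\<in>J. prob (Z s -` B s \<inter> space M))"
proof (cases "J = {}")
  case False
  have "cylinder J B = (\<Inter>s\<in>J. Z s -` B s \<inter> space M)" using False by (auto simp: cylinder_def)
  then show ?thesis using indep_varsD[OF Z_indep False assms(1,2), of B] assms(3) by simp
qed (simp add: cylinder_def prob_space)

lemma indep_from_initial: "indep_from (X 0) 1"
  unfolding indep_from_def
proof (intro allI impI, elim conjE)
  fix A and J :: "nat set" and B :: "nat \<Rightarrow> real set"
  assume A: "A \<in> sets config_space" and J: "finite J" "J \<subseteq> {1..}" and B: "\<forall>s. B s \<in> sets borel"
  let ?P = "PiM {1..} (\<lambda>_. borel) :: (nat \<Rightarrow> real) measure"
  define V :: "(nat \<Rightarrow> real) set" where "V = {f \<in> space ?P. \<forall>s\<in>J. f s \<in> B s}"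
  have V: "V \<in> sets ?P"
    unfolding V_def
  proof (rule sets.sets_Collect_finite_All[OF _ J(1)])
    fix s assume "s \<in> J"
    then have "(\<lambda>f. f s) -` B s \<inter> space ?P \<in> sets ?P"
      using J(2) B by (intro measurable_sets[OF measurable_component_singleton]) auto
    also have "(\<lambda>f. f s) -` B s \<inter> space ?P = {f \<in> space ?P. f s \<in> B s}" by auto
    finally show "{f \<in> space ?P. f s \<in> B s} \<in> sets ?P" .
  qed
  have "cylinder J B = (\<lambda>\<omega>. \<lambda>t\<in>{1..}. Z t \<omega>) -` V \<inter> space M"
    using J(2) by (auto simp: V_def cylinder_def space_PiM)
  then show "prob (X 0 -` A \<inter> space M \<inter> cylinder J B)
      = prob (X 0 -` A \<inter> space M) * prob (cylinder J B)"
    using A V by (intro indep_setD[OF Z_indep_init]) auto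
qed

lemma subalgebra_sigma: "G \<subseteq> events \<Longrightarrow> subalgebra M (sigma (space M) G)"
  unfolding subalgebra_def using sets.space_closed[of M]
  by (simp add: space_measure_of_conv sets.sigma_sets_subset subset_trans)

lemma subalgebra_tie_history: "subalgebra M (tie_history M (X 0) X' Z t)"
  unfolding tie_history_def
  using measurable_sets[OF X_measurable] measurable_sets[OF X'_measurable] measurable_sets[OF Z_measurable]
  by (intro subalgebra_sigma) blast

lemma cylinder_tie_history:
  assumes "finite J" "J \<subseteq> {1..}" "\<And>s. B s \<in> sets borel"
  shows "cylinder J B \<in> sets (tie_history M (X 0) X' Z t)"
proof -
  let ?H = "tie_history M (X 0) X' Z t"
  have sp: "space ?H = space M" using subalgebra_tie_history by (simp add: subalgebra_def)
  have Z: "Z s -` B s \<inter> space M \<in> sets ?H" if "s \<in> J" for s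
    unfolding tie_history_def
  proof (intro in_measure_of)
    have "1 \<le> s" using that assms(2) by auto
    then show "Z s -` B s \<inter> space M \<in> {X 0 -` A \<inter> space M | A. A \<in> sets config_space} \<union>
      {X' s -` A \<inter> space M | s A. s < t \<and> A \<in> sets config_space} \<union>
      {Z s -` B \<inter> space M | s B. 1 \<le> s \<and> B \<in> sets borel}"
      using assms(3)[of s] by (intro UnI2 CollectI exI[of _ s] exI[of _ "B s"]) simp
  qed blast
  have "{\<omega> \<in> space ?H. \<forall>s\<in>J. Z s \<omega> \<in> B s} \<in> sets ?H"
  proof (rule sets.sets_Collect_finite_All[OF _ assms(1)])
    fix s assume "s \<in> J"
    then have "Z s -` B s \<inter> space M \<in> sets ?H" by (rule Z)
    also have "Z s -` B s \<inter> space M = {\<omega> \<in> space ?H. Z s \<omega> \<in> B s}" by (auto simp: sp)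
    finally show "{\<omega> \<in> space ?H. Z s \<omega> \<in> B s} \<in> sets ?H" .
  qed
  then show ?thesis by (simp add: cylinder_def sp)
qed

text \<open>Breaking the tie does not create dependence on later samples. Conditionally on \<open>tie_history\<close>,
which contains all samples, the probability of \<open>X' t \<in> A\<close> is a function \<open>g\<close> of \<open>X t\<close>. For an
event \<open>E\<close> about later samples this gives \<open>P(X' t \<in> A, E) = E[g (X t); E]\<close>, and the
right-hand side factors because \<open>X t\<close> is independent of \<open>E\<close>.\<close>

lemma indep_from_core:
  assumes ind: "indep_from (X t) (Suc t)"
  shows "indep_from (X' t) (Suc t)"
  unfolding indep_from_def
proof (intro allI impI, elim conjE)
  fix A and J :: "nat set" and B :: "nat \<Rightarrow> real set"
  assume A: "A \<in> sets config_space" and J: "finite J" "J \<subseteq> {Suc t..}" and B: "\<forall>s. B s \<in> sets borel"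
  define g where "g = (\<lambda>X. if X = {#} then 0 else measure_pmf.prob (pmf_of_set (cores X)) A)"
  have [measurable]: "g \<in> borel_measurable config_space"
    unfolding g_def using A by (rule measurable_uniform_core)
  note X_measurable[of t, measurable]
  let ?H = "tie_history M (X 0) X' Z t"
  interpret H: finite_measure_subalgebra M ?H
    by standard (rule subalgebra_tie_history)
  have key: "prob (X' t -` A \<inter> space M \<inter> E) = expectation (\<lambda>\<omega>. g (X t \<omega>)) * prob E"
    if E: "E \<in> sets ?H" and indE: "\<And>A'. A' \<in> sets config_space \<Longrightarrow>
      prob (X t -` A' \<inter> space M \<inter> E) = prob (X t -` A' \<inter> space M) * prob E" for E
  proof -
    have E': "E \<in> events" using E subalgebra_tie_history by (auto simp: subalgebra_def)
    have EM: "E \<inter> space M = E" using sets.sets_into_space[OF E'] by auto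
    have ev: "X' t -` A \<inter> space M \<in> events" using X'_measurable A by (rule measurable_sets)
    have [measurable]: "X' t -` A \<inter> space M \<in> events" "E \<in> events" by fact+
    have "prob (X' t -` A \<inter> space M \<inter> E)
        = (\<integral>\<omega>. indicator E \<omega> * indicator (X' t -` A \<inter> space M) \<omega> \<partial>M)"
      using ev E' by (simp add: Int_commute[of E] flip: indicator_inter_arith)
    also have "\<dots> = (\<integral>\<omega>. indicator E \<omega> * real_cond_exp M ?H (indicator (X' t -` A \<inter> space M)) \<omega> \<partial>M)"
      using E ev E' by (intro H.real_cond_exp_intg(2)[symmetric])
        (auto simp: less_top[symmetric] intro!: integrable_real_mult_indicator[of E M "indicator (X' t -` A \<inter> space M)", simplified mult.commute])
    also have "\<dots> = (\<integral>\<omega>. g (X t \<omega>) * indicator E \<omega> \<partial>M)"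
    proof (rule integral_cong_AE)
      show "AE \<omega> in M. indicator E \<omega> * real_cond_exp M ?H (indicator (X' t -` A \<inter> space M)) \<omega>
          = g (X t \<omega>) * indicator E \<omega>"
        using core_uniform[OF A, of t]
      proof eventually_elim
        case (elim \<omega>)
        have "X t \<omega> \<noteq> {#}" if "\<omega> \<in> E"
        proof -
          have "\<omega> \<in> space M" using that EM by blast
          then show ?thesis using size_process[of \<omega> t] by auto
        qed
        then show ?case using elim by (auto simp: g_def indicator_def)
      qed
    qed (use E' in measurable)
    also have "\<dots> = expectation (\<lambda>\<omega>. g (X t \<omega>)) * expectation (indicator E)"
    proof (rule indep_var_lebesgue_integral)
      let ?S = "{(\<lambda>\<omega>. g (X t \<omega>)) -` A' \<inter> space M | A'. A' \<in> sets borel}"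
      let ?T = "{(indicator E :: 'a \<Rightarrow> real) -` B' \<inter> space M | B'. B' \<in> sets borel}"
      have "indep_set ?S ?T"
        unfolding indep_sets2_eq
      proof (intro conjI ballI)
        have "(\<lambda>\<omega>. g (X t \<omega>)) \<in> borel_measurable M" by measurable
        from measurable_sets[OF this] show "?S \<subseteq> events" by blast
        have "(indicator E :: 'a \<Rightarrow> real) \<in> borel_measurable M" by simp
        from measurable_sets[OF this] show "?T \<subseteq> events" by blast
        fix a b assume "a \<in> ?S" and "b \<in> ?T"
        then obtain A'' B' where a'': "a = (\<lambda>\<omega>. g (X t \<omega>)) -` A'' \<inter> space M" and A'': "A'' \<in> sets borel"
          and b: "b = (indicator E :: 'a \<Rightarrow> real) -` B' \<inter> space M" by blast
        define A' where "A' = g -` A'' \<inter> space config_space"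
        have A': "A' \<in> sets config_space" unfolding A'_def using A'' by measurable
        have a: "a = X t -` A' \<inter> space M" unfolding a'' A'_def by auto
        have aev: "a \<in> events" unfolding a using X_measurable A' by (rule measurable_sets)
        have "prob (a \<inter> (space M - E)) = prob a * prob (space M - E)"
        proof -
          have "a \<inter> (space M - E) = a - a \<inter> E" using a by auto
          then have "prob (a \<inter> (space M - E)) = prob a - prob (a \<inter> E)"
            using aev E' by (simp add: finite_measure_Diff)
          then show ?thesis using indE[OF A'] E' by (simp add: a[symmetric] prob_compl algebra_simps)
        qed
        moreover have "b = {} \<or> b = E \<or> b = space M - E \<or> b = space M"
        proof -
          have "b = (if 1 \<in> B' then E else {}) \<union> (if 0 \<in> B' then space M - E else {})"
          proof (rule set_eqI)
            fix x
            show "x \<in> b \<longleftrightarrow> x \<in> (if 1 \<in> B' then E else {}) \<union> (if 0 \<in> B' then space M - E else {})"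
              using sets.sets_into_space[OF E'] unfolding b by (cases "x \<in> E") auto
          qed
          moreover have "E \<union> (space M - E) = space M" using EM by blast
          ultimately show ?thesis by simp
        qed
        moreover have "a \<inter> space M = a" using a by auto
        ultimately show "prob (a \<inter> b) = prob a * prob b"
          using indE[OF A'] by (auto simp: a[symmetric] prob_space)
      qed
      then show "indep_var borel (\<lambda>\<omega>. g (X t \<omega>)) borel (indicator E :: 'a \<Rightarrow> real)"
        unfolding indep_var_eq
        by (intro conjI indep_set_sigma_sets) (auto intro!: Int_stable_vimage)
      have "\<bar>g X\<bar> \<le> 1" for X by (simp add: g_def)
      then show "integrable M (\<lambda>\<omega>. g (X t \<omega>))"
        by (intro integrable_const_bound[of _ 1]) auto
      show "integrable M (indicator E :: 'a \<Rightarrow> real)"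
        using E' by (intro integrable_real_indicator) (auto simp: less_top[symmetric])
    qed
    also have "expectation (indicator E) = prob E" using E' EM by simp
    finally show ?thesis .
  qed
  have "space M \<in> sets ?H"
    using sets.top[of ?H] subalgebra_tie_history[of t] unfolding subalgebra_def by simp
  then have "prob (X' t -` A \<inter> space M \<inter> space M) = expectation (\<lambda>\<omega>. g (X t \<omega>)) * prob (space M)"
    by (rule key) (simp add: Int_assoc prob_space)
  then have "prob (X' t -` A \<inter> space M) = expectation (\<lambda>\<omega>. g (X t \<omega>))"
    by (simp add: Int_assoc prob_space)
  moreover have "prob (X' t -` A \<inter> space M \<inter> cylinder J B)
      = expectation (\<lambda>\<omega>. g (X t \<omega>)) * prob (cylinder J B)"
    using J B by (intro key cylinder_tie_history indep_fromD[OF ind]) auto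
  ultimately show "prob (X' t -` A \<inter> space M \<inter> cylinder J B)
      = prob (X' t -` A \<inter> space M) * prob (cylinder J B)" by simp
qed

text \<open>The configuration \<open>X (Suc t)\<close> is a function of \<open>X' t\<close> and \<open>Z (Suc t)\<close>. Events about this pair
are generated by rectangles, for which the product formula comes from the induction hypothesis
applied to the samples from time \<open>Suc t\<close> on.\<close>

lemma indep_from_step:
  assumes ind: "indep_from (X' t) (Suc t)"
  shows "indep_from (X (Suc t)) (Suc (Suc t))"
  unfolding indep_from_def
proof (intro allI impI, elim conjE)
  fix A and J :: "nat set" and B :: "nat \<Rightarrow> real set"
  assume A: "A \<in> sets config_space" and J: "finite J" "J \<subseteq> {Suc (Suc t)..}" and B: "\<forall>s. B s \<in> sets borel"
  let ?Z = "Z (Suc t)"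
  define \<A> where "\<A> = {(X' t -` A' \<inter> space M) \<inter> (?Z -` B' \<inter> space M) | A' B'.
    A' \<in> sets config_space \<and> B' \<in> sets borel}"
  have A_ev: "\<A> \<subseteq> events"
  proof
    fix a assume "a \<in> \<A>"
    then obtain A' B' where *: "A' \<in> sets config_space" "B' \<in> sets borel"
      and a: "a = (X' t -` A' \<inter> space M) \<inter> (?Z -` B' \<inter> space M)" unfolding \<A>_def by blast
    show "a \<in> events"
      unfolding a using * by (intro sets.Int measurable_sets[OF X'_measurable]
        measurable_sets[OF Z_measurable]) auto
  qed
  have cyl: "cylinder J B \<in> events" using J B by (intro cylinder_events) auto
  have "indep_set \<A> {cylinder J B}"
    unfolding indep_sets2_eq
  proof (intro conjI ballI)
    fix a b assume "a \<in> \<A>" and "b \<in> {cylinder J B}"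
    then obtain A' B' where a: "a = (X' t -` A' \<inter> space M) \<inter> (?Z -` B' \<inter> space M)"
      and A': "A' \<in> sets config_space" and B': "B' \<in> sets borel" and b: "b = cylinder J B"
      unfolding \<A>_def by blast
    have nJ: "Suc t \<notin> J" using J(2) by auto
    let ?B = "B(Suc t := B')"
    have bB: "\<And>s. ?B s \<in> sets borel" using B B' by simp
    have 1: "a = X' t -` A' \<inter> space M \<inter> cylinder {Suc t} ?B"
      by (auto simp: a cylinder_def)
    have 2: "a \<inter> b = X' t -` A' \<inter> space M \<inter> cylinder (insert (Suc t) J) ?B"
      using nJ by (auto simp: a b cylinder_def)
    have 3: "prob (cylinder (insert (Suc t) J) ?B) = prob (cylinder {Suc t} ?B) * prob (cylinder J B)"
    proof -
      have "prob (cylinder (insert (Suc t) J) ?B) = (\<Prod>s\<in>insert (Suc t) J. prob (Z s -` ?B s \<inter> space M))"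
        using J bB by (intro prob_cylinder) auto
      also have "\<dots> = prob (Z (Suc t) -` ?B (Suc t) \<inter> space M) * (\<Prod>s\<in>J. prob (Z s -` B s \<inter> space M))"
        using J nJ by (auto intro!: prod.cong)
      also have "prob (Z (Suc t) -` ?B (Suc t) \<inter> space M) = prob (cylinder {Suc t} ?B)"
        using prob_cylinder[of "{Suc t}" ?B] bB by simp
      also have "(\<Prod>s\<in>J. prob (Z s -` B s \<inter> space M)) = prob (cylinder J B)"
        using J B by (intro prob_cylinder[symmetric]) auto
      finally show ?thesis .
    qed
    have "prob a = prob (X' t -` A' \<inter> space M) * prob (cylinder {Suc t} ?B)"
      unfolding 1 using bB by (intro indep_fromD[OF ind A']) auto
    moreover have "prob (a \<inter> b) = prob (X' t -` A' \<inter> space M) * prob (cylinder (insert (Suc t) J) ?B)"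
      unfolding 2 using J bB by (intro indep_fromD[OF ind A']) auto
    ultimately show "prob (a \<inter> b) = prob a * prob b" using 3 b by simp
  qed (use A_ev cyl in auto)
  moreover have "Int_stable \<A>"
    unfolding Int_stable_def \<A>_def
  proof (intro ballI, safe)
    fix A1 A2 and B1 B2 :: "real set"
    assume *: "A1 \<in> sets config_space" "A2 \<in> sets config_space" "B1 \<in> sets borel" "B2 \<in> sets borel"
    show "\<exists>A' B'. (X' t -` A1 \<inter> space M) \<inter> (?Z -` B1 \<inter> space M) \<inter>
          ((X' t -` A2 \<inter> space M) \<inter> (?Z -` B2 \<inter> space M))
        = (X' t -` A' \<inter> space M) \<inter> (?Z -` B' \<inter> space M) \<and> A' \<in> sets config_space \<and> B' \<in> sets borel"
      using * by (intro exI[of _ "A1 \<inter> A2"] exI[of _ "B1 \<inter> B2"]) auto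
  qed
  ultimately have ind': "indep_set (sigma_sets (space M) \<A>) (sigma_sets (space M) {cylinder J B})"
    by (rule indep_set_sigma_sets) (simp add: Int_stable_def)
  let ?S = "sigma (space M) \<A>"
  have AS: "\<A> \<subseteq> Pow (space M)" by (auto simp: \<A>_def)
  have spS: "space ?S = space M" by (simp add: space_measure_of_conv)
  have [measurable]: "X' t \<in> measurable ?S config_space"
  proof (rule measurableI)
    fix A' assume "A' \<in> sets config_space"
    then have "X' t -` A' \<inter> space M \<in> \<A>"
      unfolding \<A>_def by (intro CollectI exI[of _ A'] exI[of _ UNIV]) auto
    then show "X' t -` A' \<inter> space ?S \<in> sets ?S" using AS by (simp add: spS)
  qed simp
  have [measurable]: "?Z \<in> borel_measurable ?S"
  proof (rule measurableI)
    fix B' :: "real set" assume "B' \<in> sets borel"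
    then have "?Z -` B' \<inter> space M \<in> \<A>"
      unfolding \<A>_def using sets.top[of config_space]
      by (intro CollectI exI[of _ B'] exI[of _ UNIV]) auto
    then show "?Z -` B' \<inter> space ?S \<in> sets ?S" using AS by (simp add: spS)
  qed simp
  have "(\<lambda>\<omega>. add_mset (?Z \<omega>) (X' t \<omega>)) \<in> measurable ?S config_space" by measurable
  from measurable_sets[OF this A]
  have "(\<lambda>\<omega>. add_mset (?Z \<omega>) (X' t \<omega>)) -` A \<inter> space M \<in> sigma_sets (space M) \<A>"
    using AS by (simp add: spS)
  also have "(\<lambda>\<omega>. add_mset (?Z \<omega>) (X' t \<omega>)) -` A \<inter> space M = X (Suc t) -` A \<inter> space M"
    using step by auto
  finally show "prob (X (Suc t) -` A \<inter> space M \<inter> cylinder J B)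
      = prob (X (Suc t) -` A \<inter> space M) * prob (cylinder J B)"
    by (rule indep_setD[OF ind']) auto
qed

lemma indep_from_X': "indep_from (X' t) (Suc t)"
proof -
  have "indep_from (X t) (Suc t)" for t
    by (induction t) (auto intro: indep_from_initial[simplified] indep_from_step indep_from_core)
  then show ?thesis by (rule indep_from_core)
qed

lemma distr_core_sample:
  "distr M (config_space \<Otimes>\<^sub>M borel) (\<lambda>\<omega>. (X' t \<omega>, Z (Suc t) \<omega>))
    = distr M config_space (X' t) \<Otimes>\<^sub>M distr D borel \<zeta>"
proof -
  let ?P = "distr M (config_space \<Otimes>\<^sub>M borel) (\<lambda>\<omega>. (X' t \<omega>, Z (Suc t) \<omega>))"
  note [measurable] = X'_measurable[of t] Z_measurable[of "Suc t", simplified]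
  interpret X': prob_space "distr M config_space (X' t)" by (rule prob_space_distr) measurable
  interpret Z: prob_space "distr M borel (Z (Suc t))" by (rule prob_space_distr) measurable
  have "distr M config_space (X' t) \<Otimes>\<^sub>M distr M borel (Z (Suc t)) = ?P"
  proof (rule pair_measure_eqI)
    fix A B assume "A \<in> sets (distr M config_space (X' t))" "B \<in> sets (distr M borel (Z (Suc t)))"
    then have [measurable]: "A \<in> sets config_space" "B \<in> sets borel" by simp_all
    have c: "cylinder {Suc t} (\<lambda>_. B) = Z (Suc t) -` B \<inter> space M" by (auto simp: cylinder_def)
    have eq: "(\<lambda>\<omega>. (X' t \<omega>, Z (Suc t) \<omega>)) -` (A \<times> B) \<inter> space M
        = X' t -` A \<inter> space M \<inter> (Z (Suc t) -` B \<inter> space M)" by auto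
    have "prob (X' t -` A \<inter> space M \<inter> (Z (Suc t) -` B \<inter> space M))
        = prob (X' t -` A \<inter> space M) * prob (Z (Suc t) -` B \<inter> space M)"
      using indep_fromD[OF indep_from_X', of A "{Suc t}" t "\<lambda>_. B"] by (simp add: c)
    then show "emeasure (distr M config_space (X' t)) A * emeasure (distr M borel (Z (Suc t))) B
        = emeasure ?P (A \<times> B)"
      by (simp add: emeasure_distr eq emeasure_eq_measure ennreal_mult)
  qed (auto intro: X'.sigma_finite_measure_axioms Z.sigma_finite_measure_axioms simp: cong: sets_pair_measure_cong)
  then show ?thesis using Z_distr[of "Suc t"] by simp
qed

end

section \<open>Charging weights to the decrease of the core size\<close>

context jante_process
begin

lemma config_G_X'_Suc_le:
  assumes "\<omega> \<in> space M"
  shows "config_G (X' (Suc t) \<omega>) \<le> config_G (X' t \<omega>)"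
  using cores_add_G_le core[OF assms, of "Suc t"] step[OF assms, of t] by simp

lemma decseq_config_G: "\<omega> \<in> space M \<Longrightarrow> decseq (\<lambda>t. config_G (X' t \<omega>))"
  by (intro decseq_SucI config_G_X'_Suc_le)

lemma contraction_bounds:
  assumes "1 \<le> n"
  shows "0 \<le> contraction n" "contraction n < 1"
proof -
  have "1 \<le> (real n)^2" using assms by simp
  then have "1 / (4 * (real n)^2) \<le> 1" by (simp add: divide_le_eq)
  then show "0 \<le> contraction n" by (simp add: contraction_def)
  show "contraction n < 1" using assms by (simp add: contraction_def)
qed

text \<open>The probabilistic core of the proof. The core \<open>y\<close> at time \<open>t\<close> is independent of the next sample,
so the expected weight \<open>w y\<close> collected when the sample falls into the section of \<open>S\<close> is at most
\<open>K\<close> times the expected weight collected when the sample is contracting. In the latter case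
\<open>min (sqrt (config_G y)) L\<close> drops by at least a fixed multiple of \<open>w y\<close>. As this quantity decreases
along every path and lies between \<open>0\<close> and \<open>L\<close>, the total of all drops is bounded by \<open>L\<close>. The
truncation at \<open>L\<close> gives this bound for every law of the initial configuration.\<close>

lemma summable_weighted_visits:
  fixes w :: "real multiset \<Rightarrow> real" and S :: "(real multiset \<times> real) set"
  assumes N: "2 \<le> N" and D: "prob_space D" and \<zeta>: "\<zeta> \<in> borel_measurable D"
    and w [measurable]: "w \<in> borel_measurable config_space" and w0: "\<And>y. 0 \<le> w y"
    and S [measurable]: "S \<in> sets (config_space \<Otimes>\<^sub>M borel)"
    and a: "0 \<le> a" "\<And>y. w y \<le> a * sqrt (config_G y)"
    and L: "0 \<le> L" "\<And>y. 0 < w y \<Longrightarrow> sqrt (config_G y) \<le> L"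
    and K: "0 \<le> K" "\<And>y. size y = N - 1 \<Longrightarrow> 0 < w y \<Longrightarrow>
      measure (distr D borel \<zeta>) (Pair y -` S) \<le> K * measure (distr D borel \<zeta>) (contracting (N - 1) y)"
  shows "AE \<omega> in M. summable (\<lambda>t. w (X' t \<omega>) * indicator S (X' t \<omega>, Z (Suc t) \<omega>))"
proof -
  define n where "n = N - 1"
  have n: "1 \<le> n" using N by (simp add: n_def)
  define Q where "Q = distr D borel \<zeta>"
  have [measurable_cong]: "sets Q = sets borel" by (simp add: Q_def)
  interpret Q: prob_space Q unfolding Q_def using D \<zeta> by (rule prob_space.prob_space_distr)
  note [measurable] = X'_measurable Z_measurable[of "Suc _", simplified]
  have szn: "size (X' t \<omega>) = n" if "\<omega> \<in> space M" for t \<omega>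
    using size_process(2)[OF that, of t] by (simp add: n_def)
  define H where "H = {p \<in> space (config_space \<Otimes>\<^sub>M (borel :: real measure)).
    size (fst p) = n \<and> snd p \<in> contracting n (fst p)}"
  have [measurable]: "H \<in> sets (config_space \<Otimes>\<^sub>M borel)"
    unfolding H_def by (rule measurable_contracting)
  have law: "(\<integral>\<^sup>+\<omega>. ennreal (w (X' t \<omega>)) * indicator V (X' t \<omega>, Z (Suc t) \<omega>) \<partial>M)
      = (\<integral>\<^sup>+y. ennreal (w y) * emeasure Q (Pair y -` V) \<partial>distr M config_space (X' t))"
    if [measurable]: "V \<in> sets (config_space \<Otimes>\<^sub>M borel)" for V t
  proof -
    let ?f = "\<lambda>p. ennreal (w (fst p)) * indicator V p :: ennreal"
    have [measurable]: "V \<in> sets (config_space \<Otimes>\<^sub>M Q)"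
      using that sets_pair_measure_cong[of config_space config_space Q borel] \<open>sets Q = sets borel\<close> by simp
    have "(\<integral>\<^sup>+\<omega>. ?f (X' t \<omega>, Z (Suc t) \<omega>) \<partial>M)
        = (\<integral>\<^sup>+p. ?f p \<partial>distr M (config_space \<Otimes>\<^sub>M borel) (\<lambda>\<omega>. (X' t \<omega>, Z (Suc t) \<omega>)))"
      by (subst nn_integral_distr) auto
    also have "\<dots> = (\<integral>\<^sup>+p. ?f p \<partial>(distr M config_space (X' t) \<Otimes>\<^sub>M Q))"
      by (simp add: distr_core_sample Q_def)
    also have "\<dots> = (\<integral>\<^sup>+y. \<integral>\<^sup>+z. ?f (y, z) \<partial>Q \<partial>distr M config_space (X' t))"
      by (subst Q.nn_integral_fst[symmetric]) auto
    also have "\<dots> = (\<integral>\<^sup>+y. ennreal (w y) * emeasure Q (Pair y -` V) \<partial>distr M config_space (X' t))"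
    proof (rule nn_integral_cong)
      fix y
      have [measurable]: "Pair y -` V \<in> sets Q" by (rule sets_Pair1) measurable
      have "(\<integral>\<^sup>+z. ?f (y, z) \<partial>Q) = (\<integral>\<^sup>+z. ennreal (w y) * indicator (Pair y -` V) z \<partial>Q)"
        by (intro nn_integral_cong) (simp add: indicator_def)
      also have "\<dots> = ennreal (w y) * emeasure Q (Pair y -` V)"
        by (rule nn_integral_cmult_indicator) measurable
      finally show "(\<integral>\<^sup>+z. ?f (y, z) \<partial>Q) = ennreal (w y) * emeasure Q (Pair y -` V)" .
    qed
    finally show ?thesis by simp
  qed
  have comparison: "(\<integral>\<^sup>+\<omega>. ennreal (w (X' t \<omega>)) * indicator S (X' t \<omega>, Z (Suc t) \<omega>) \<partial>M)
      \<le> ennreal K * (\<integral>\<^sup>+\<omega>. ennreal (w (X' t \<omega>)) * indicator H (X' t \<omega>, Z (Suc t) \<omega>) \<partial>M)" for t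
  proof -
    let ?\<mu> = "distr M config_space (X' t)"
    have "{y \<in> space config_space. size y = n} \<in> sets config_space" by measurable
    then have szAE: "AE y in ?\<mu>. size y = n"
      using szn by (subst AE_distr_iff) auto
    have "(\<integral>\<^sup>+y. ennreal (w y) * emeasure Q (Pair y -` S) \<partial>?\<mu>)
        \<le> (\<integral>\<^sup>+y. ennreal K * (ennreal (w y) * emeasure Q (Pair y -` H)) \<partial>?\<mu>)"
    proof (rule nn_integral_mono_AE)
      show "AE y in ?\<mu>. ennreal (w y) * emeasure Q (Pair y -` S)
          \<le> ennreal K * (ennreal (w y) * emeasure Q (Pair y -` H))"
        using szAE
      proof eventually_elim
        case (elim y)
        have "Pair y -` H = contracting n y"
          using elim by (auto simp: H_def space_pair_measure)
        moreover have "emeasure Q (Pair y -` S) \<le> ennreal K * emeasure Q (contracting n y)" if "0 < w y"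
        proof -
          have "Q.prob (Pair y -` S) \<le> K * Q.prob (contracting n y)"
            using K(2)[of y] that elim by (simp add: Q_def n_def)
          then show ?thesis
            using K(1) by (simp add: Q.emeasure_eq_measure ennreal_leI flip: ennreal_mult)
        qed
        ultimately have "ennreal (w y) * emeasure Q (Pair y -` S)
            \<le> ennreal (w y) * (ennreal K * emeasure Q (Pair y -` H))"
          using w0[of y] by (cases "w y = 0") (auto intro!: mult_left_mono)
        then show ?case by (simp only: mult.left_commute)
      qed
    qed
    also have "\<dots> = ennreal K * (\<integral>\<^sup>+y. ennreal (w y) * emeasure Q (Pair y -` H) \<partial>?\<mu>)"
    proof (rule nn_integral_cmult)
      have "H \<in> sets (config_space \<Otimes>\<^sub>M Q)"
        using sets_pair_measure_cong[of config_space config_space Q borel] \<open>sets Q = sets borel\<close> by simp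
      from Q.measurable_emeasure_Pair[OF this]
      show "(\<lambda>y. ennreal (w y) * emeasure Q (Pair y -` H)) \<in> borel_measurable ?\<mu>" by measurable
    qed
    finally show ?thesis by (simp add: law)
  qed
  define \<rho> where "\<rho> = sqrt (contraction n)"
  have \<rho>: "0 \<le> \<rho>" "\<rho> < 1" using contraction_bounds[OF n] by (auto simp: \<rho>_def)
  define \<phi> where "\<phi> t \<omega> = min (sqrt (config_G (X' t \<omega>))) L" for t \<omega>
  have \<phi>: "0 \<le> \<phi> t \<omega>" "\<phi> t \<omega> \<le> L" for t \<omega> using L(1) config_G_nonneg by (auto simp: \<phi>_def)
  have drop: "(1 - \<rho>) * (w (X' t \<omega>) * indicator H (X' t \<omega>, Z (Suc t) \<omega>)) \<le> a * (\<phi> t \<omega> - \<phi> (Suc t) \<omega>)"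
    if \<omega>: "\<omega> \<in> space M" for t \<omega>
  proof (cases "(X' t \<omega>, Z (Suc t) \<omega>) \<in> H \<and> 0 < w (X' t \<omega>)")
    case True
    let ?F = "config_G (X' t \<omega>)" and ?F' = "config_G (X' (Suc t) \<omega>)"
    have "?F' \<le> contraction n * ?F"
      using True core[OF \<omega>, of "Suc t"] step[OF \<omega>, of t]
      by (intro cores_add_contracting[of _ "Z (Suc t) \<omega>"]) (auto simp: H_def)
    then have "sqrt ?F' \<le> \<rho> * sqrt ?F"
      by (metis \<rho>_def real_sqrt_le_iff real_sqrt_mult)
    moreover have "\<phi> t \<omega> = sqrt ?F" using True L(2) by (simp add: \<phi>_def)
    moreover have "\<phi> (Suc t) \<omega> \<le> sqrt ?F'" by (simp add: \<phi>_def)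
    ultimately have "(1 - \<rho>) * sqrt ?F \<le> \<phi> t \<omega> - \<phi> (Suc t) \<omega>" by (simp add: algebra_simps)
    from mult_left_mono[OF this a(1)]
    have "(1 - \<rho>) * (a * sqrt ?F) \<le> a * (\<phi> t \<omega> - \<phi> (Suc t) \<omega>)" by (simp add: algebra_simps)
    moreover have "(1 - \<rho>) * w (X' t \<omega>) \<le> (1 - \<rho>) * (a * sqrt ?F)"
      using a(2) \<rho> by (intro mult_left_mono) auto
    ultimately show ?thesis using True by simp
  next
    case False
    have "\<phi> (Suc t) \<omega> \<le> \<phi> t \<omega>"
      unfolding \<phi>_def using real_sqrt_le_mono[OF config_G_X'_Suc_le[OF \<omega>, of t]] by linarith
    moreover have "w (X' t \<omega>) * indicator H (X' t \<omega>, Z (Suc t) \<omega>) = 0"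
      using False w0[of "X' t \<omega>"] by (auto simp: indicator_def)
    moreover from this have "0 \<le> a * (\<phi> t \<omega> - \<phi> (Suc t) \<omega>)"
      using a(1) \<open>\<phi> (Suc t) \<omega> \<le> \<phi> t \<omega>\<close> by simp
    ultimately show ?thesis by (simp only: mult_zero_right)
  qed
  define B where "B = a * L / (1 - \<rho>)"
  have total: "(\<Sum>t. ennreal (w (X' t \<omega>)) * indicator H (X' t \<omega>, Z (Suc t) \<omega>)) \<le> ennreal B"
    if \<omega>: "\<omega> \<in> space M" for \<omega>
  proof (rule suminf_le_const[OF summableI])
    fix T
    have "(1 - \<rho>) * (\<Sum>t<T. w (X' t \<omega>) * indicator H (X' t \<omega>, Z (Suc t) \<omega>))
        \<le> (\<Sum>t<T. a * (\<phi> t \<omega> - \<phi> (Suc t) \<omega>))"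
      unfolding sum_distrib_left by (intro sum_mono drop \<omega>)
    also have "\<dots> = a * (\<phi> 0 \<omega> - \<phi> T \<omega>)"
      using sum_lessThan_telescope'[of "\<lambda>t. \<phi> t \<omega>" T] by (simp add: sum_distrib_left[symmetric])
    also have "\<dots> \<le> a * L"
      using \<phi>[of 0 \<omega>] \<phi>[of T \<omega>] a(1) by (intro mult_left_mono) linarith+
    finally have "(\<Sum>t<T. w (X' t \<omega>) * indicator H (X' t \<omega>, Z (Suc t) \<omega>)) \<le> B"
      using \<rho> by (simp add: B_def pos_le_divide_eq mult.commute)
    moreover have "(\<Sum>t<T. ennreal (w (X' t \<omega>)) * indicator H (X' t \<omega>, Z (Suc t) \<omega>))
        = ennreal (\<Sum>t<T. w (X' t \<omega>) * indicator H (X' t \<omega>, Z (Suc t) \<omega>))"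
      using w0 by (subst sum_ennreal[symmetric]) (auto simp: ennreal_mult ennreal_indicator)
    ultimately show "(\<Sum>t<T. ennreal (w (X' t \<omega>)) * indicator H (X' t \<omega>, Z (Suc t) \<omega>)) \<le> ennreal B"
      by (simp add: ennreal_leI)
  qed
  have "(\<integral>\<^sup>+\<omega>. (\<Sum>t. ennreal (w (X' t \<omega>)) * indicator S (X' t \<omega>, Z (Suc t) \<omega>)) \<partial>M)
      = (\<Sum>t. \<integral>\<^sup>+\<omega>. ennreal (w (X' t \<omega>)) * indicator S (X' t \<omega>, Z (Suc t) \<omega>) \<partial>M)"
    by (rule nn_integral_suminf) measurable
  also have "\<dots> \<le> (\<Sum>t. ennreal K * (\<integral>\<^sup>+\<omega>. ennreal (w (X' t \<omega>)) * indicator H (X' t \<omega>, Z (Suc t) \<omega>) \<partial>M))"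
    by (intro suminf_le summableI comparison)
  also have "\<dots> = ennreal K * (\<integral>\<^sup>+\<omega>. (\<Sum>t. ennreal (w (X' t \<omega>)) * indicator H (X' t \<omega>, Z (Suc t) \<omega>)) \<partial>M)"
    by (subst nn_integral_suminf) auto
  also have "\<dots> \<le> ennreal K * (\<integral>\<^sup>+\<omega>. ennreal B \<partial>M)"
    using total by (intro mult_left_mono nn_integral_mono) auto
  also have "\<dots> < \<infinity>"
    by (simp add: emeasure_space_1 ennreal_mult_less_top)
  finally have "(\<integral>\<^sup>+\<omega>. (\<Sum>t. ennreal (w (X' t \<omega>)) * indicator S (X' t \<omega>, Z (Suc t) \<omega>)) \<partial>M) \<noteq> \<infinity>"
    by simp
  then have "AE \<omega> in M. (\<Sum>t. ennreal (w (X' t \<omega>)) * indicator S (X' t \<omega>, Z (Suc t) \<omega>)) \<noteq> \<infinity>"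
    by (rule nn_integral_PInf_AE[rotated]) measurable
  then show ?thesis
  proof eventually_elim
    case (elim \<omega>)
    show ?case
    proof (rule summable_suminf_not_top)
      show "0 \<le> w (X' t \<omega>) * indicator S (X' t \<omega>, Z (Suc t) \<omega>)" for t using w0 by simp
      have "ennreal (w (X' t \<omega>)) * indicator S (X' t \<omega>, Z (Suc t) \<omega>)
          = ennreal (w (X' t \<omega>) * indicator S (X' t \<omega>, Z (Suc t) \<omega>))" for t
        using w0 by (simp add: ennreal_mult ennreal_indicator)
      then show "(\<Sum>t. ennreal (w (X' t \<omega>) * indicator S (X' t \<omega>, Z (Suc t) \<omega>))) \<noteq> top"
        using elim by simp
    qed
  qed
qed

lemma AE_core_subset_supp:
  assumes D: "prob_space D" and \<zeta>: "\<zeta> \<in> borel_measurable D"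
  shows "AE \<omega> in M. \<forall>t. set_mset (X' t \<omega>) \<subseteq> rv_supp D \<zeta>"
proof -
  have "AE \<omega> in M. Z (Suc t) \<omega> \<in> rv_supp D \<zeta>" for t
  proof -
    have "AE x in distr M borel (Z (Suc t)). x \<in> rv_supp D \<zeta>"
      using open_Compl_rv_supp(2)[OF D \<zeta>] Z_distr[of "Suc t"] by (intro AE_I'[of "- rv_supp D \<zeta>"]) auto
    then show ?thesis
      using open_Compl_rv_supp(1)[OF D \<zeta>] Z_measurable[of "Suc t"]
      by (subst (asm) AE_distr_iff) (auto simp: closed_def[symmetric])
  qed
  then have "AE \<omega> in M. \<forall>t. Z (Suc t) \<omega> \<in> rv_supp D \<zeta>" by (simp add: AE_all_countable)
  then show ?thesis
    using AE_space
  proof eventually_elim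
    case (elim \<omega>)
    show ?case
    proof
      fix t
      have XX': "set_mset (X' t \<omega>) \<subseteq> set_mset (X t \<omega>)" for t
        using core[OF elim(2), of t] by (auto simp: cores_def is_arg_min_def dest: mset_subset_eqD)
      have "set_mset (X t \<omega>) \<subseteq> rv_supp D \<zeta>"
      proof (induction t)
        case 0
        then show ?case using init[OF elim(2)] by auto
      next
        case (Suc t)
        then show ?case using step[OF elim(2), of t] XX'[of t] elim(1) by auto
      qed
      then show "set_mset (X' t \<omega>) \<subseteq> rv_supp D \<zeta>" using XX'[of t] by blast
    qed
  qed
qed

end

section \<open>Real sequences with summable rises\<close>

lemma convergent_bounded_upward_variation:
  fixes x :: "nat \<Rightarrow> real"
  assumes sum: "summable (\<lambda>t. max 0 (x (Suc t) - x t))" and low: "\<And>t. b \<le> x t"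
  shows "convergent x"
proof -
  let ?S = "\<lambda>t. \<Sum>r<t. max 0 (x (Suc r) - x r)"
  have conv: "convergent ?S" using sum by (simp add: summable_iff_convergent)
  have "convergent (\<lambda>t. x t - ?S t)"
  proof -
    have d: "decseq (\<lambda>t. x t - ?S t)" by (rule decseq_SucI) simp
    have "b - suminf (\<lambda>t. max 0 (x (Suc t) - x t)) \<le> x t - ?S t" for t
    proof -
      have "?S t \<le> suminf (\<lambda>t. max 0 (x (Suc t) - x t))"
        by (rule sum_le_suminf[OF sum]) auto
      with low[of t] show ?thesis by linarith
    qed
    then obtain l where "(\<lambda>t. x t - ?S t) \<longlonglongrightarrow> l" using decseq_convergent[OF d] by blast
    then show ?thesis by (rule convergentI)
  qed
  from convergent_add[OF this conv] show ?thesis by simp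
qed

lemma summable_shift_if:
  assumes "summable (\<lambda>t. if P t then f t else (0::real))" and "eventually P sequentially"
  shows "summable f"
proof -
  have "\<forall>\<^sub>F t in sequentially. (if P t then f t else 0) = f t"
    using assms(2) by eventually_elim simp
  from summable_cong[OF this] assms(1) show ?thesis by simp
qed

lemma convergent_of_gated_rises:
  fixes x m :: "nat \<Rightarrow> real"
  assumes sum: "summable (\<lambda>t. if R \<le> m t then max 0 (x (Suc t) - x t) else 0)"
    and ev: "\<forall>\<^sub>F t in sequentially. R \<le> m t" and le: "\<And>t. m t \<le> x t"
  shows "convergent x"
proof -
  obtain T where T: "\<And>t. T \<le> t \<Longrightarrow> R \<le> m t" using ev by (auto simp: eventually_sequentially)
  have "summable (\<lambda>t. max 0 (x (Suc t) - x t))" using sum ev by (rule summable_shift_if)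
  then have "summable (\<lambda>t. max 0 (x (Suc (t + T)) - x (t + T)))"
    by (rule summable_ignore_initial_segment)
  then have "convergent (\<lambda>t. x (t + T))"
    by (intro convergent_bounded_upward_variation[where b = R])
      (auto intro: order_trans[OF T le])
  then show ?thesis by (simp add: convergent_ignore_initial_segment)
qed

text \<open>Think of \<open>m t \<le> x t\<close> as the ends of a shrinking interval. With \<open>4 * e = Rm - Rp\<close>, wait until its
length, the jumps and the tail of the summable rises are all below \<open>e\<close>. If \<open>x\<close> is ever below
\<open>Rp + e\<close> after that, it overshoots this level by at most one jump, and while it is above the level
the left end is beyond \<open>Rp\<close>, so that all further rises count in the tail. Hence it never
passes \<open>Rp + 3 * e\<close>.\<close>

lemma eventually_one_sided:
  fixes m x :: "nat \<Rightarrow> real"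
  assumes sum: "summable (\<lambda>t. if Rp \<le> m t then max 0 (x (Suc t) - x t) else 0)"
    and R: "Rp < Rm" and diam: "(\<lambda>t. x t - m t) \<longlonglongrightarrow> 0"
    and jump: "\<And>t. x (Suc t) \<le> x t + J t" "J \<longlonglongrightarrow> 0"
  shows "(\<forall>\<^sub>F t in sequentially. Rp \<le> m t) \<or> (\<forall>\<^sub>F t in sequentially. x t \<le> Rm)"
proof -
  define e where "e = (Rm - Rp) / 4"
  have e: "0 < e" using R by (simp add: e_def)
  let ?c = "\<lambda>t. if Rp \<le> m t then max 0 (x (Suc t) - x t) else 0"
  have c0: "0 \<le> ?c t" for t by simp
  have 1: "\<forall>\<^sub>F t in sequentially. x t - m t < e" using diam e by (rule order_tendstoD(2))
  have 2: "\<forall>\<^sub>F t in sequentially. J t < e" using jump(2) e by (rule order_tendstoD(2))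
  obtain T0 where T0: "\<And>a b. T0 \<le> a \<Longrightarrow> norm (sum ?c {a..<b}) < e"
    using sum e unfolding summable_Cauchy by blast
  obtain T1 where T1: "\<And>t. T1 \<le> t \<Longrightarrow> x t - m t < e \<and> J t < e"
    using eventually_conj[OF 1 2] by (auto simp: eventually_sequentially)
  define T where "T = max T0 T1"
  show ?thesis
  proof (cases "\<forall>t\<ge>T. Rp + e \<le> x t")
    case True
    have "Rp \<le> m t" if "T \<le> t" for t using True that T1[of t] by (force simp: T_def)
    then show ?thesis unfolding eventually_sequentially by blast
  next
    case False
    then obtain s where s: "T \<le> s" "x s < Rp + e" by auto
    \<comment> \<open>The bound consists of the level \<open>Rp + e\<close>, one jump, and the counted rises since time \<open>s\<close>.\<close>
    have inv: "x t \<le> Rp + 2 * e + sum ?c {s..<t}" if "s \<le> t" for t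
      using that
    proof (induction t rule: dec_induct)
      case base
      then show ?case using s e by simp
    next
      case (step t)
      have t: "T1 \<le> t" using step s by (simp add: T_def)
      have sm: "sum ?c {s..<Suc t} = sum ?c {s..<t} + ?c t" using step by simp
      show ?case
      proof (cases "x t < Rp + e")
        case True
        have "0 \<le> sum ?c {s..<Suc t}" by (intro sum_nonneg c0)
        then show ?thesis using True jump(1)[of t] T1[OF t] by linarith
      next
        case False
        then have "Rp \<le> m t" using T1[OF t] by linarith
        then have "x (Suc t) \<le> x t + ?c t" by simp
        then show ?thesis using step sm by linarith
      qed
    qed
    have "x t \<le> Rm" if "s \<le> t" for t
    proof -
      have "norm (sum ?c {s..<t}) < e" using s by (intro T0) (simp add: T_def)
      then have "sum ?c {s..<t} < e" by simp
      then show ?thesis using inv[OF that] e by (simp add: e_def field_simps)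
    qed
    then show ?thesis unfolding eventually_sequentially by blast
  qed
qed

section \<open>Motion of the end points of the core\<close>

context jante_process
begin

text \<open>By \<open>config_diff_le\<close>, \<open>spread\<close> bounds the diameter of the core; by \<open>Max_increase\<close> and
\<open>Min_decrease\<close> it also bounds the outward jumps of the end points.\<close>

abbreviation left :: "'a \<Rightarrow> nat \<Rightarrow> real" where "left \<omega> t \<equiv> Min (set_mset (X' t \<omega>))"
abbreviation right :: "'a \<Rightarrow> nat \<Rightarrow> real" where "right \<omega> t \<equiv> Max (set_mset (X' t \<omega>))"
abbreviation spread :: "'a \<Rightarrow> nat \<Rightarrow> real" where "spread \<omega> t \<equiv> sqrt 2 * sqrt (config_G (X' t \<omega>))"

lemma X'_nonempty: "2 \<le> N \<Longrightarrow> \<omega> \<in> space M \<Longrightarrow> X' t \<omega> \<noteq> {#}"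
  using size_process(2)[of \<omega> t] by auto

lemma left_right:
  assumes "2 \<le> N" "\<omega> \<in> space M"
  shows "left \<omega> t \<le> right \<omega> t" "right \<omega> t - left \<omega> t \<le> spread \<omega> t"
    "left \<omega> t \<in># X' t \<omega>" "right \<omega> t \<in># X' t \<omega>"
proof -
  show in': "left \<omega> t \<in># X' t \<omega>" "right \<omega> t \<in># X' t \<omega>" using X'_nonempty[OF assms, of t] by auto
  then show "left \<omega> t \<le> right \<omega> t" by simp
  show "right \<omega> t - left \<omega> t \<le> spread \<omega> t"
    using config_diff_le[OF in'(2,1)] by linarith
qed

lemma right_jump:
  assumes N: "3 \<le> N" and \<omega>: "\<omega> \<in> space M" and "right \<omega> t < right \<omega> (Suc t)"
  shows "Z (Suc t) \<omega> = right \<omega> (Suc t)" "right \<omega> (Suc t) \<le> right \<omega> t + spread \<omega> t"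
proof -
  have c: "X' (Suc t) \<omega> \<in> cores (add_mset (Z (Suc t) \<omega>) (X' t \<omega>))"
    using core[OF \<omega>, of "Suc t"] step[OF \<omega>, of t] by simp
  have sz: "2 \<le> size (X' t \<omega>)" using size_process(2)[OF \<omega>, of t] N by simp
  show z: "Z (Suc t) \<omega> = right \<omega> (Suc t)" by (rule Max_increase(1)[OF c sz assms(3)])
  show "right \<omega> (Suc t) \<le> right \<omega> t + spread \<omega> t"
    using Max_increase(2)[OF c sz assms(3)] z by simp
qed

lemma left_jump:
  assumes N: "3 \<le> N" and \<omega>: "\<omega> \<in> space M" and "left \<omega> (Suc t) < left \<omega> t"
  shows "Z (Suc t) \<omega> = left \<omega> (Suc t)" "left \<omega> t - spread \<omega> t \<le> left \<omega> (Suc t)"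
proof -
  have c: "X' (Suc t) \<omega> \<in> cores (add_mset (Z (Suc t) \<omega>) (X' t \<omega>))"
    using core[OF \<omega>, of "Suc t"] step[OF \<omega>, of t] by simp
  have sz: "2 \<le> size (X' t \<omega>)" using size_process(2)[OF \<omega>, of t] N by simp
  show z: "Z (Suc t) \<omega> = left \<omega> (Suc t)" by (rule Min_decrease(1)[OF c sz assms(3)])
  show "left \<omega> t - spread \<omega> t \<le> left \<omega> (Suc t)"
    using Min_decrease(2)[OF c sz assms(3)] z by simp
qed

lemma spread_nonneg: "0 \<le> spread \<omega> t"
  using config_G_nonneg by simp

lemma spread_decseq: "\<omega> \<in> space M \<Longrightarrow> s \<le> t \<Longrightarrow> spread \<omega> t \<le> spread \<omega> s"
  using decseqD[OF decseq_config_G] by simp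

lemma spread_tendsto_0:
  assumes "(\<lambda>t. config_G (X' t \<omega>)) \<longlonglongrightarrow> 0"
  shows "spread \<omega> \<longlonglongrightarrow> 0"
proof -
  have "spread \<omega> \<longlonglongrightarrow> sqrt 2 * sqrt 0" using assms by (intro tendsto_intros)
  then show ?thesis by simp
qed

lemma configs_tendsto_of_selection:
  assumes N: "2 \<le> N" and \<omega>: "\<omega> \<in> space M"
    and F: "(\<lambda>t. config_G (X' t \<omega>)) \<longlonglongrightarrow> 0"
    and x: "x \<longlonglongrightarrow> \<phi>" and xin: "\<And>t. x t \<in># X' t \<omega>"
  shows "configs_tendsto (\<lambda>t. X' t \<omega>) \<phi>"
  unfolding configs_tendsto_def
proof (intro allI impI)
  fix e :: real assume e: "0 < e"
  have "\<forall>\<^sub>F t in sequentially. spread \<omega> t < e / 2"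
    using order_tendstoD(2)[OF spread_tendsto_0[OF F] half_gt_zero[OF e]] .
  moreover have "\<forall>\<^sub>F t in sequentially. dist (x t) \<phi> < e / 2" using x e by (intro tendstoD) auto
  ultimately show "\<forall>\<^sub>F t in sequentially. \<forall>y\<in>#X' t \<omega>. \<bar>y - \<phi>\<bar> < e"
  proof eventually_elim
    case (elim t)
    show ?case
    proof
      fix y assume "y \<in># X' t \<omega>"
      then have "\<bar>y - x t\<bar> \<le> spread \<omega> t" using xin by (intro config_diff_le)
      then show "\<bar>y - \<phi>\<bar> < e" using elim unfolding dist_real_def by linarith
    qed
  qed
qed

end

section \<open>Almost sure behaviour under one-sided doubling\<close>

locale doubling_jante_process = jante_process +
  fixes Rp Rm C :: real
  assumes N: "3 \<le> N" and D: "prob_space D" and \<zeta>: "\<zeta> \<in> borel_measurable D" and C: "0 \<le> C"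
    and doubling_right: "\<And>a u. Rp \<le> a \<Longrightarrow> 0 < u \<Longrightarrow>
      \<P>(\<omega> in D. a + u < \<zeta> \<omega> \<and> \<zeta> \<omega> \<le> a + 2 * u) \<le> C * \<P>(\<omega> in D. a < \<zeta> \<omega> \<and> \<zeta> \<omega> \<le> a + u)"
    and doubling_left: "\<And>a u. a \<le> Rm \<Longrightarrow> u < 0 \<Longrightarrow>
      \<P>(\<omega> in D. a + 2 * u < \<zeta> \<omega> \<and> \<zeta> \<omega> \<le> a + u) \<le> C * \<P>(\<omega> in D. a + u < \<zeta> \<omega> \<and> \<zeta> \<omega> \<le> a)"
begin

lemma N2: "2 \<le> N" using N by simp

abbreviation Q :: "real measure" where "Q \<equiv> distr D borel \<zeta>"

lemma Q_interval: "measure Q {a<..b} = \<P>(\<omega> in D. a < \<zeta> \<omega> \<and> \<zeta> \<omega> \<le> b)"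
  using \<zeta> by (subst measure_distr) (auto intro!: arg_cong[where f = "measure D"])

lemma finite_measure_Q: "finite_measure Q"
proof -
  interpret Q: prob_space Q using D \<zeta> by (rule prob_space.prob_space_distr)
  show ?thesis by unfold_locales
qed

text \<open>The function \<open>e\<close> is an end point of the core, with the sign that makes outward moves positive, and
the gate \<open>g\<close> says that the core lies where the doubling hypothesis for this direction holds. Every
rise costs at most \<open>spread\<close>, which is the weight that can be charged to contracting samples. The
truncation level \<open>L\<close> is chosen above the initial value, separately on each path.\<close>

lemma AE_summable_gated_rises:
  fixes e :: "real multiset \<Rightarrow> real" and S :: "(real multiset \<times> real) set"
  assumes g [measurable]: "Measurable.pred config_space g"
    and S: "S \<in> sets (config_space \<Otimes>\<^sub>M borel)" and K: "0 \<le> K"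
    and mass: "\<And>y. size y = N - 1 \<Longrightarrow> g y \<Longrightarrow>
      measure Q (Pair y -` S) \<le> K * measure Q (contracting (N - 1) y)"
    and rise: "\<And>\<omega> t. \<omega> \<in> space M \<Longrightarrow> e (X' t \<omega>) < e (X' (Suc t) \<omega>) \<Longrightarrow>
      (X' t \<omega>, Z (Suc t) \<omega>) \<in> S \<and> e (X' (Suc t) \<omega>) \<le> e (X' t \<omega>) + spread \<omega> t"
  shows "AE \<omega> in M. summable (\<lambda>t. if g (X' t \<omega>) then max 0 (e (X' (Suc t) \<omega>) - e (X' t \<omega>)) else 0)"
proof -
  define w where "w L y = (if g y \<and> sqrt (config_G y) \<le> real L then sqrt (config_G y) else 0)"
    for L :: nat and y
  have [measurable]: "w L \<in> borel_measurable config_space" for L unfolding w_def by measurable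
  have "AE \<omega> in M. summable (\<lambda>t. w L (X' t \<omega>) * indicator S (X' t \<omega>, Z (Suc t) \<omega>))" for L
  proof (rule summable_weighted_visits[where a = 1 and L = "real L" and K = K, OF N2 D \<zeta>])
    fix y :: "real multiset" assume y: "size y = N - 1" "0 < w L y"
    then have "g y" by (simp add: w_def split: if_splits)
    with y(1) show "measure Q (Pair y -` S) \<le> K * measure Q (contracting (N - 1) y)" by (rule mass)
  qed (auto simp: w_def config_G_nonneg K S split: if_splits)
  then have "AE \<omega> in M. \<forall>L. summable (\<lambda>t. w L (X' t \<omega>) * indicator S (X' t \<omega>, Z (Suc t) \<omega>))"
    by (simp add: AE_all_countable)
  then show ?thesis
    using AE_space
  proof eventually_elim
    case (elim \<omega>)
    obtain L :: nat where L: "sqrt (config_G (X' 0 \<omega>)) \<le> real L" using real_arch_simple by blast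
    let ?v = "\<lambda>t. sqrt 2 * (w L (X' t \<omega>) * indicator S (X' t \<omega>, Z (Suc t) \<omega>))"
    have v: "summable ?v" using elim(1) by (intro summable_mult) blast
    show ?case
    proof (rule summable_comparison_test'[OF v, of 0])
      fix t
      have G: "sqrt (config_G (X' t \<omega>)) \<le> real L"
        using decseqD[OF decseq_config_G[OF elim(2)], of 0 t] L by (simp add: order_trans[rotated])
      show "norm (if g (X' t \<omega>) then max 0 (e (X' (Suc t) \<omega>) - e (X' t \<omega>)) else 0) \<le> ?v t"
      proof (cases "g (X' t \<omega>) \<and> e (X' t \<omega>) < e (X' (Suc t) \<omega>)")
        case True
        then have "w L (X' t \<omega>) = sqrt (config_G (X' t \<omega>))" using G by (simp add: w_def)
        then show ?thesis using rise[OF elim(2), of t] True by simp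
      next
        case False
        have "0 \<le> ?v t" by (simp add: w_def config_G_nonneg)
        moreover have "(if g (X' t \<omega>) then max 0 (e (X' (Suc t) \<omega>) - e (X' t \<omega>)) else 0) = 0"
          using False by auto
        ultimately show ?thesis by (simp only: norm_zero)
      qed
    qed
  qed
qed

lemma AE_summable_right:
  "AE \<omega> in M. summable (\<lambda>t. if Rp \<le> left \<omega> t then max 0 (right \<omega> (Suc t) - right \<omega> t) else 0)"
proof -
  define S where "S = {p \<in> space (config_space \<Otimes>\<^sub>M (borel :: real measure)).
    Max (set_mset (fst p)) < snd p \<and> snd p \<le> Max (set_mset (fst p)) + sqrt 2 * sqrt (config_G (fst p))}"
  show ?thesis
  proof (rule AE_summable_gated_rises[where g = "\<lambda>y. Rp \<le> Min (set_mset y)" and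
        e = "\<lambda>y. Max (set_mset y)" and S = S and K = "\<Sum>j<chain_length (N - 1). C ^ j"])
    fix y :: "real multiset" assume y: "size y = N - 1" "Rp \<le> Min (set_mset y)"
    have "Pair y -` S = {Max (set_mset y)<..Max (set_mset y) + sqrt 2 * sqrt (config_G y)}"
      by (auto simp: S_def space_pair_measure)
    then show "measure Q (Pair y -` S)
        \<le> (\<Sum>j<chain_length (N - 1). C ^ j) * measure Q (contracting (N - 1) y)"
      using right_jump_mass[OF finite_measure_Q _ y(1), of C Rp] y(2) N C doubling_right
      by (simp add: Q_interval)
  next
    fix \<omega> t assume "\<omega> \<in> space M" "right \<omega> t < right \<omega> (Suc t)"
    with right_jump[OF N this] show
      "(X' t \<omega>, Z (Suc t) \<omega>) \<in> S \<and> right \<omega> (Suc t) \<le> right \<omega> t + spread \<omega> t"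
      by (simp add: S_def space_pair_measure)
  next
    show "S \<in> sets (config_space \<Otimes>\<^sub>M borel)" unfolding S_def by measurable
  qed (use C in \<open>auto intro: sum_nonneg\<close>)
qed

lemma AE_summable_left:
  "AE \<omega> in M. summable (\<lambda>t. if right \<omega> t \<le> Rm then max 0 (left \<omega> t - left \<omega> (Suc t)) else 0)"
proof -
  define S where "S = {p \<in> space (config_space \<Otimes>\<^sub>M (borel :: real measure)).
    Min (set_mset (fst p)) - sqrt 2 * sqrt (config_G (fst p)) \<le> snd p \<and> snd p < Min (set_mset (fst p))}"
  have "AE \<omega> in M. summable (\<lambda>t. if right \<omega> t \<le> Rm then max 0 (- left \<omega> (Suc t) - - left \<omega> t) else 0)"
  proof (rule AE_summable_gated_rises[where g = "\<lambda>y. Max (set_mset y) \<le> Rm" and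
        e = "\<lambda>y. - Min (set_mset y)" and S = S and K = "\<Sum>j<chain_length (N - 1). C ^ j"])
    fix y :: "real multiset" assume y: "size y = N - 1" "Max (set_mset y) \<le> Rm"
    have "Pair y -` S = {Min (set_mset y) - sqrt 2 * sqrt (config_G y)..<Min (set_mset y)}"
      by (auto simp: S_def space_pair_measure)
    then show "measure Q (Pair y -` S)
        \<le> (\<Sum>j<chain_length (N - 1). C ^ j) * measure Q (contracting (N - 1) y)"
      using left_jump_mass[OF finite_measure_Q _ y(1), of C Rm] y(2) N C doubling_left
      by (simp add: Q_interval)
  next
    fix \<omega> t assume \<omega>: "\<omega> \<in> space M" and "- left \<omega> t < - left \<omega> (Suc t)"
    then have "left \<omega> (Suc t) < left \<omega> t" by simp
    with left_jump[OF N \<omega> this] show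
      "(X' t \<omega>, Z (Suc t) \<omega>) \<in> S \<and> - left \<omega> (Suc t) \<le> - left \<omega> t + spread \<omega> t"
      by (simp add: S_def space_pair_measure)
  next
    show "S \<in> sets (config_space \<Otimes>\<^sub>M borel)" unfolding S_def by measurable
  qed (use C in \<open>auto intro: sum_nonneg\<close>)
  moreover have "- b - - a = a - b" for a b :: real by simp
  ultimately show ?thesis by (simp only:)
qed

lemma AE_convergent:
  "AE \<omega> in M. ((\<forall>\<^sub>F t in sequentially. Rp \<le> left \<omega> t) \<longrightarrow> convergent (right \<omega>)) \<and>
    ((\<forall>\<^sub>F t in sequentially. right \<omega> t \<le> Rm) \<longrightarrow> convergent (left \<omega>))"
  using AE_summable_right AE_summable_left AE_space
proof eventually_elim
  case (elim \<omega>)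
  show ?case
  proof (intro conjI impI)
    assume "\<forall>\<^sub>F t in sequentially. Rp \<le> left \<omega> t"
    then show "convergent (right \<omega>)"
      using elim(1) left_right(1)[OF N2 elim(3)] by (intro convergent_of_gated_rises[of Rp "left \<omega>"])
  next
    assume ev: "\<forall>\<^sub>F t in sequentially. right \<omega> t \<le> Rm"
    have "convergent (\<lambda>t. - left \<omega> t)"
    proof (rule convergent_of_gated_rises[of "- Rm" "\<lambda>t. - right \<omega> t"])
      show "summable (\<lambda>t. if - Rm \<le> - right \<omega> t then max 0 (- left \<omega> (Suc t) - - left \<omega> t) else 0)"
        using elim(2) by (simp cong: if_cong)
    qed (use ev left_right(1)[OF N2 elim(3)] in auto)
    then show "convergent (left \<omega>)" by (simp add: convergent_minus_iff[symmetric])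
  qed
qed

text \<open>Once all points are farther from the origin than \<open>k\<close>, which bounds the diameter and the jumps,
the core can neither straddle the origin nor cross it.\<close>

lemma one_sided_of_to_infinity:
  assumes \<omega>: "\<omega> \<in> space M" and inf: "configs_to_infinity (\<lambda>t. X' t \<omega>)"
  shows "(\<forall>\<^sub>F t in sequentially. r \<le> left \<omega> t) \<or> (\<forall>\<^sub>F t in sequentially. right \<omega> t \<le> r')"
proof -
  define k where "k = max (max \<bar>r\<bar> \<bar>r'\<bar>) (spread \<omega> 0)"
  have "\<forall>\<^sub>F t in sequentially. k < Min (abs ` set_mset (X' t \<omega>))"
    using inf unfolding configs_to_infinity_def filterlim_at_top_dense by blast
  then obtain T where T: "\<And>t. T \<le> t \<Longrightarrow> k < Min (abs ` set_mset (X' t \<omega>))"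
    by (auto simp: eventually_sequentially)
  have k: "k < \<bar>left \<omega> t\<bar>" "k < \<bar>right \<omega> t\<bar>" if "T \<le> t" for t
  proof -
    have "Min (abs ` set_mset (X' t \<omega>)) \<le> \<bar>x\<bar>" if "x \<in># X' t \<omega>" for x
      using that by (intro Min_le) auto
    then show "k < \<bar>left \<omega> t\<bar>" "k < \<bar>right \<omega> t\<bar>"
      using T[OF that] left_right(3,4)[OF N2 \<omega>, of t] by (auto intro: less_le_trans)
  qed
  have k0: "0 \<le> k" "spread \<omega> t \<le> k" for t
    unfolding k_def using spread_decseq[OF \<omega>, of 0 t] spread_nonneg[of 0 \<omega>] by linarith+
  show ?thesis
  proof (cases "\<forall>t\<ge>T. 0 \<le> left \<omega> t")
    case True
    then have "r \<le> left \<omega> t" if "T \<le> t" for t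
      using k(1)[OF that] that by (auto simp: k_def)
    then show ?thesis unfolding eventually_sequentially by blast
  next
    case False
    then obtain s where s: "T \<le> s" "left \<omega> s < 0" by auto
    have side: "right \<omega> t < - k" if "T \<le> t" "left \<omega> t < 0" for t
      using k[OF that(1)] that(2) left_right(2)[OF N2 \<omega>, of t] k0(1) k0(2)[of t] by linarith
    have "left \<omega> t < 0" if "s \<le> t" for t
      using that
    proof (induction t rule: dec_induct)
      case base
      then show ?case by (rule s(2))
    next
      case (step t)
      have "right \<omega> t < - k" using side[of t] step s(1) by simp
      moreover have "right \<omega> (Suc t) \<le> right \<omega> t + k"
      proof (cases "right \<omega> t < right \<omega> (Suc t)")
        case True
        then show ?thesis using right_jump(2)[OF N \<omega> True] k0(2)[of t] by linarith
      qed (use k0(1) in linarith)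
      ultimately show ?case using left_right(1)[OF N2 \<omega>, of "Suc t"] by linarith
    qed
    then have "right \<omega> t \<le> r'" if "s \<le> t" for t
      using side[of t] that s(1) by (force simp: k_def)
    then show ?thesis unfolding eventually_sequentially by blast
  qed
qed

lemma not_to_infinity_of_convergent:
  assumes "convergent x" and "\<And>t. x t \<in># Y t"
  shows "\<not> configs_to_infinity Y"
proof
  assume inf: "configs_to_infinity Y"
  obtain b where b: "\<And>t. norm (x t) \<le> b" using convergent_imp_Bseq[OF assms(1)] by (auto simp: Bseq_def)
  have "\<forall>\<^sub>F t in sequentially. b < Min (abs ` set_mset (Y t))"
    using inf unfolding configs_to_infinity_def filterlim_at_top_dense by blast
  then obtain t where "b < Min (abs ` set_mset (Y t))"
    by (auto simp: eventually_sequentially)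
  also have "\<dots> \<le> \<bar>x t\<bar>" using assms(2)[of t] by (intro Min_le) auto
  finally show False using b[of t] by simp
qed

lemma AE_not_to_infinity: "AE \<omega> in M. \<not> configs_to_infinity (\<lambda>t. X' t \<omega>)"
  using AE_convergent AE_space
proof eventually_elim
  case (elim \<omega>)
  show ?case
  proof
    assume inf: "configs_to_infinity (\<lambda>t. X' t \<omega>)"
    from one_sided_of_to_infinity[OF elim(2) inf] elim(1)
    have "convergent (right \<omega>) \<or> convergent (left \<omega>)" by blast
    then show False
      using not_to_infinity_of_convergent[of _ "\<lambda>t. X' t \<omega>"] left_right(3,4)[OF N2 elim(2)] inf by blast
  qed
qed

text \<open>A core that meets a bounded region and is at most of size \<open>L\<close> lies in a compact part of the
support, and if its size is at least \<open>\<delta>\<close>, then the samples within a fixed distance of its most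
central point are contracting. Their probability has a positive lower bound \<open>p\<close>, so every such visit can be charged, at the rate \<open>1 / p\<close>, to a contracting sample.\<close>

lemma AE_finitely_many_bounded_visits:
  assumes \<delta>: "0 < \<delta>"
  shows "AE \<omega> in M. \<forall>\<^sub>F t in sequentially.
    \<not> ((\<exists>x\<in>#X' t \<omega>. \<bar>x\<bar> \<le> r) \<and> \<delta> \<le> sqrt (config_G (X' t \<omega>)) \<and> sqrt (config_G (X' t \<omega>)) \<le> L)"
proof (cases "0 \<le> L")
  case L: True
  define n where "n = N - 1"
  have n: "2 \<le> n" using N by (simp add: n_def)
  let ?V = "rv_supp D \<zeta>"
  have V: "closed ?V" "- ?V \<in> sets borel" using open_Compl_rv_supp(1)[OF D \<zeta>] by (auto simp: closed_def)
  define w where "w y = (if set_mset y \<subseteq> ?V \<and> (\<exists>x\<in>#y. \<bar>x\<bar> \<le> r) \<and>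
      \<delta> \<le> sqrt (config_G y) \<and> sqrt (config_G y) \<le> L then 1 else 0 :: real)" for y
  have w [measurable]: "w \<in> borel_measurable config_space"
  proof -
    have w_eq: "w = (\<lambda>y. if size (filter_mset (\<lambda>x. x \<in> - ?V) y) = 0 \<and>
        size (filter_mset (\<lambda>x. x \<in> {-r..r}) y) \<noteq> 0 \<and>
        \<delta> \<le> sqrt (config_G y) \<and> sqrt (config_G y) \<le> L then 1 else 0)"
      unfolding w_def size_filter_eq_0 by (intro ext if_cong) (auto simp: abs_le_iff minus_le_iff)
    note [measurable] = measurable_config_count[OF V(2)] measurable_config_count[of "{-r..r}"]
    show ?thesis unfolding w_eq by measurable
  qed
  \<comment> \<open>A core that has a point in \<open>[-r, r]\<close> and is not larger than \<open>L\<close> has all its points in this ball.\<close>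
  define K where "K = ?V \<inter> cball 0 (r + sqrt 2 * L)"
  have "compact K" unfolding K_def using V(1) by (simp add: closed_Int_compact)
  then obtain p where p: "0 < p" "\<And>x. x \<in> K \<Longrightarrow> p \<le> measure Q (ball x (contraction_radius n * \<delta>))"
    using compact_supp_mass[OF D \<zeta>, of K "contraction_radius n * \<delta>"] \<delta> n
    by (auto simp: K_def contraction_radius_def)
  interpret Q: prob_space Q using D \<zeta> by (rule prob_space.prob_space_distr)
  have "AE \<omega> in M. summable (\<lambda>t. w (X' t \<omega>) * indicator (space (config_space \<Otimes>\<^sub>M borel)) (X' t \<omega>, Z (Suc t) \<omega>))"
  proof (rule summable_weighted_visits[where a = "1 / \<delta>" and L = L and K = "1 / p", OF N2 D \<zeta>])
    show "w y \<le> 1 / \<delta> * sqrt (config_G y)" for y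
      using \<delta> config_G_nonneg[of y] by (auto simp: w_def pos_le_divide_eq)
    show "w \<in> borel_measurable config_space" by (rule w)
    fix y :: "real multiset" assume y: "size y = N - 1" "0 < w y"
    then have y': "set_mset y \<subseteq> ?V" "\<delta> \<le> sqrt (config_G y)" "sqrt (config_G y) \<le> L"
      by (auto simp: w_def split: if_splits)
    obtain x where x: "x \<in># y" "\<bar>x\<bar> \<le> r" using y(2) by (auto simp: w_def split: if_splits)
    obtain z0 where z0: "z0 \<in># y"
      and near: "\<And>z. \<bar>z - z0\<bar> \<le> contraction_radius n * sqrt (config_G y) \<Longrightarrow> z \<in> contracting n y"
      using near_central_point_contracting[OF y(1)[folded n_def]] n by auto
    have "\<bar>z0 - x\<bar> \<le> sqrt 2 * sqrt (config_G y)" using z0 x(1) by (rule config_diff_le)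
    also have "\<dots> \<le> sqrt 2 * L" using y'(3) by simp
    finally have "z0 \<in> K" using z0 x(2) y'(1) by (auto simp: K_def)
    then have "p \<le> measure Q (ball z0 (contraction_radius n * \<delta>))" by (rule p(2))
    also have "\<dots> \<le> measure Q (contracting n y)"
    proof (rule Q.finite_measure_mono)
      have "contraction_radius n * \<delta> \<le> contraction_radius n * sqrt (config_G y)"
        using y'(2) by (intro mult_left_mono) (auto simp: contraction_radius_def)
      then show "ball z0 (contraction_radius n * \<delta>) \<subseteq> contracting n y"
        using near by (auto simp: dist_real_def abs_minus_commute)
      show "contracting n y \<in> sets Q" using contracting_borel[of y n] y(1) by (simp add: n_def)
    qed
    finally have "1 \<le> 1 / p * measure Q (contracting n y)" using p(1) by (simp add: pos_le_divide_eq)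
    then show "measure Q (Pair y -` space (config_space \<Otimes>\<^sub>M borel)) \<le> 1 / p * measure Q (contracting (N - 1) y)"
      using order_trans[OF Q.prob_le_1] by (simp add: n_def)
  qed (use L \<delta> p(1) in \<open>auto simp: w_def split: if_splits\<close>)
  then show ?thesis
    using AE_core_subset_supp[OF D \<zeta>]
  proof eventually_elim
    case (elim \<omega>)
    have "(\<lambda>t. w (X' t \<omega>)) \<longlonglongrightarrow> 0"
      using summable_LIMSEQ_zero[OF elim(1)] by (simp add: space_pair_measure)
    then have "\<forall>\<^sub>F t in sequentially. w (X' t \<omega>) < 1" by (rule order_tendstoD(2)) simp
    then show ?case
    proof eventually_elim
      case (elim t)
      then show ?case using \<open>\<forall>t. set_mset (X' t \<omega>) \<subseteq> ?V\<close> by (auto simp: w_def split: if_splits)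
    qed
  qed
next
  case False
  then have "\<not> sqrt (config_G y) \<le> L" for y
    using real_sqrt_ge_zero[OF config_G_nonneg[of y]] by linarith
  then show ?thesis by simp
qed

text \<open>If the decreasing values of \<open>config_G\<close> had a positive limit, then every bounded region would be
visited only finitely often and the core would tend to infinity.\<close>

lemma AE_config_G_tendsto_0: "AE \<omega> in M. (\<lambda>t. config_G (X' t \<omega>)) \<longlonglongrightarrow> 0"
proof -
  have "AE \<omega> in M. \<forall>j k l :: nat. \<forall>\<^sub>F t in sequentially.
      \<not> ((\<exists>x\<in>#X' t \<omega>. \<bar>x\<bar> \<le> real j) \<and> inverse (real (Suc k)) \<le> sqrt (config_G (X' t \<omega>)) \<and>
        sqrt (config_G (X' t \<omega>)) \<le> real l)"
    unfolding AE_all_countable by (intro allI AE_finitely_many_bounded_visits) simp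
  with AE_not_to_infinity AE_space show ?thesis
  proof eventually_elim
    case (elim \<omega>)
    let ?F = "\<lambda>t. config_G (X' t \<omega>)"
    obtain f where f: "?F \<longlonglongrightarrow> f" "\<And>t. f \<le> ?F t"
      using decseq_convergent[OF decseq_config_G[OF elim(2)], of 0] config_G_nonneg by blast
    have f0: "0 \<le> f" using f(1) config_G_nonneg by (intro LIMSEQ_le_const) auto
    have "f = 0"
    proof (rule ccontr)
      assume "f \<noteq> 0"
      then have "0 < sqrt f" using f0 by simp
      then obtain k where k: "inverse (real (Suc k)) < sqrt f" using reals_Archimedean by blast
      obtain l :: nat where l: "sqrt (?F 0) \<le> real l" using real_arch_simple by blast
      have b: "inverse (real (Suc k)) \<le> sqrt (?F t)" "sqrt (?F t) \<le> real l" for t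
      proof -
        have "sqrt f \<le> sqrt (?F t)" using f(2) by simp
        then show "inverse (real (Suc k)) \<le> sqrt (?F t)" using k by linarith
        have "sqrt (?F t) \<le> sqrt (?F 0)" using decseqD[OF decseq_config_G[OF elim(2)], of 0 t] by simp
        then show "sqrt (?F t) \<le> real l" using l by linarith
      qed
      have "filterlim (\<lambda>t. Min (abs ` set_mset (X' t \<omega>))) at_top sequentially"
        unfolding filterlim_at_top
      proof
        fix c :: real
        obtain j :: nat where j: "c \<le> real j" using real_arch_simple by blast
        have "\<forall>\<^sub>F t in sequentially. \<not> ((\<exists>x\<in>#X' t \<omega>. \<bar>x\<bar> \<le> real j) \<and>
            inverse (real (Suc k)) \<le> sqrt (?F t) \<and> sqrt (?F t) \<le> real l)"
          using elim(3) by blast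
        then show "\<forall>\<^sub>F t in sequentially. c \<le> Min (abs ` set_mset (X' t \<omega>))"
        proof eventually_elim
          case (elim t)
          then have "\<forall>x\<in>#X' t \<omega>. c \<le> \<bar>x\<bar>" using b[of t] j by force
          then show ?case using X'_nonempty[OF N2 \<open>\<omega> \<in> space M\<close>, of t] by simp
        qed
      qed
      then show False using elim(1) by (simp add: configs_to_infinity_def)
    qed
    then show ?case using f(1) by simp
  qed
qed

lemma AE_tendsto_of_one_sided:
  "AE \<omega> in M. (\<forall>\<^sub>F t in sequentially. Rp \<le> left \<omega> t) \<or> (\<forall>\<^sub>F t in sequentially. right \<omega> t \<le> Rm)
    \<longrightarrow> (\<exists>\<phi>. configs_tendsto (\<lambda>t. X' t \<omega>) \<phi>)"
  using AE_convergent AE_config_G_tendsto_0 AE_space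
proof eventually_elim
  case (elim \<omega>)
  show ?case
  proof
    assume "(\<forall>\<^sub>F t in sequentially. Rp \<le> left \<omega> t) \<or> (\<forall>\<^sub>F t in sequentially. right \<omega> t \<le> Rm)"
    then have "convergent (right \<omega>) \<or> convergent (left \<omega>)" using elim(1) by blast
    then show "\<exists>\<phi>. configs_tendsto (\<lambda>t. X' t \<omega>) \<phi>"
      using configs_tendsto_of_selection[OF N2 elim(3,2)] left_right(3,4)[OF N2 elim(3)]
      unfolding convergent_def by blast
  qed
qed

lemma AE_one_sided:
  assumes "Rp < Rm"
  shows "AE \<omega> in M. (\<forall>\<^sub>F t in sequentially. Rp \<le> left \<omega> t) \<or> (\<forall>\<^sub>F t in sequentially. right \<omega> t \<le> Rm)"
  using AE_summable_right AE_config_G_tendsto_0 AE_space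
proof eventually_elim
  case (elim \<omega>)
  note spread = spread_tendsto_0[OF elim(2)]
  show ?case
  proof (rule eventually_one_sided[OF elim(1) assms _ _ spread])
    show "(\<lambda>t. right \<omega> t - left \<omega> t) \<longlonglongrightarrow> 0"
      by (rule tendsto_sandwich[OF _ _ tendsto_const spread])
        (auto simp: left_right[OF N2 elim(3)])
    show "right \<omega> (Suc t) \<le> right \<omega> t + spread \<omega> t" for t
      using right_jump(2)[OF N elim(3), of t] spread_nonneg[of t \<omega>]
      by (cases "right \<omega> t < right \<omega> (Suc t)") auto
  qed
qed

lemma configs_tendsto_iff:
  assumes "\<And>t. Y t \<noteq> {#}"
  shows "configs_tendsto Y \<phi> \<longleftrightarrow>
    (\<lambda>t. Min (set_mset (Y t))) \<longlonglongrightarrow> \<phi> \<and> (\<lambda>t. Max (set_mset (Y t))) \<longlonglongrightarrow> \<phi>"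
proof -
  have "(\<forall>x\<in>#Y t. \<bar>x - \<phi>\<bar> < e) \<longleftrightarrow>
      \<bar>Min (set_mset (Y t)) - \<phi>\<bar> < e \<and> \<bar>Max (set_mset (Y t)) - \<phi>\<bar> < e" for t e
  proof
    assume "\<forall>x\<in>#Y t. \<bar>x - \<phi>\<bar> < e"
    then show "\<bar>Min (set_mset (Y t)) - \<phi>\<bar> < e \<and> \<bar>Max (set_mset (Y t)) - \<phi>\<bar> < e"
      using assms[of t] by simp
  next
    assume *: "\<bar>Min (set_mset (Y t)) - \<phi>\<bar> < e \<and> \<bar>Max (set_mset (Y t)) - \<phi>\<bar> < e"
    show "\<forall>x\<in>#Y t. \<bar>x - \<phi>\<bar> < e"
    proof
      fix x assume "x \<in># Y t"
      then have "Min (set_mset (Y t)) \<le> x" "x \<le> Max (set_mset (Y t))" by auto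
      with * show "\<bar>x - \<phi>\<bar> < e" by linarith
    qed
  qed
  then show ?thesis
    unfolding configs_tendsto_def tendsto_iff dist_real_def by (auto simp: eventually_conj_iff)
qed

text \<open>Convergence of the core means that both end points, which are random variables, converge to the
same limit. Measurability is what turns almost sure convergence into convergence with probability
one.\<close>

lemma configs_tendsto_event: "{\<omega> \<in> space M. \<exists>\<phi>. configs_tendsto (\<lambda>t. X' t \<omega>) \<phi>} \<in> events"
proof -
  note X'_measurable [measurable]
  have "{\<omega> \<in> space M. \<exists>\<phi>. configs_tendsto (\<lambda>t. X' t \<omega>) \<phi>} =
    {\<omega> \<in> space M. Cauchy (left \<omega>)} \<inter> {\<omega> \<in> space M. Cauchy (right \<omega>)} \<inter>
    {\<omega> \<in> space M. lim (left \<omega>) = lim (right \<omega>)}"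
    using configs_tendsto_iff[OF X'_nonempty[OF N2]]
    by (auto simp: Cauchy_convergent_iff convergent_def limI)
  also have "\<dots> \<in> events"
    by (intro sets.Int sets_Collect_Cauchy) measurable
  finally show ?thesis .
qed

end

theorem theorem3:
  fixes M :: "'a measure" and D :: "'b measure" and \<zeta> :: "'b \<Rightarrow> real"
    and N :: nat and X X' :: "nat \<Rightarrow> 'a \<Rightarrow> real multiset" and Z :: "nat \<Rightarrow> 'a \<Rightarrow> real"
    and Rp Rm C :: real
  assumes "3 \<le> N"
    and "prob_space D" and "\<zeta> \<in> borel_measurable D"
    and "0 \<le> C"
    and "\<And>a u. Rp \<le> a \<Longrightarrow> 0 < u \<Longrightarrow>
      \<P>(\<omega> in D. a + u < \<zeta> \<omega> \<and> \<zeta> \<omega> \<le> a + 2 * u) \<le> C * \<P>(\<omega> in D. a < \<zeta> \<omega> \<and> \<zeta> \<omega> \<le> a + u)"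
    and "\<And>a u. a \<le> Rm \<Longrightarrow> u < 0 \<Longrightarrow>
      \<P>(\<omega> in D. a + 2 * u < \<zeta> \<omega> \<and> \<zeta> \<omega> \<le> a + u) \<le> C * \<P>(\<omega> in D. a + u < \<zeta> \<omega> \<and> \<zeta> \<omega> \<le> a)"
    and "jante_process M N D \<zeta> X X' Z"
  shows "(AE \<omega> in M. \<not> configs_to_infinity (\<lambda>t. X' t \<omega>))
    \<and> (AE \<omega> in M. (\<lambda>t. config_G (X' t \<omega>)) \<longlonglongrightarrow> 0)
    \<and> (AE \<omega> in M.
         liminf (\<lambda>t. ereal (Min (set_mset (X' t \<omega>)))) > ereal Rp \<or>
         limsup (\<lambda>t. ereal (Max (set_mset (X' t \<omega>)))) < ereal Rm
         \<longrightarrow> (\<exists>\<phi>. configs_tendsto (\<lambda>t. X' t \<omega>) \<phi>))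
    \<and> (Rm > Rp \<longrightarrow> \<P>(\<omega> in M. \<exists>\<phi>. configs_tendsto (\<lambda>t. X' t \<omega>) \<phi>) = 1)"
proof -
  interpret jante_process M N D \<zeta> X X' Z by fact
  interpret doubling_jante_process M N D \<zeta> X X' Z Rp Rm C
    by (rule doubling_jante_process.intro[OF assms(7) doubling_jante_process_axioms.intro[OF assms(1-6)]])
  show ?thesis
  proof (intro conjI impI AE_not_to_infinity AE_config_G_tendsto_0)
    show "AE \<omega> in M. liminf (\<lambda>t. ereal (left \<omega> t)) > ereal Rp \<or> limsup (\<lambda>t. ereal (right \<omega> t)) < ereal Rm
         \<longrightarrow> (\<exists>\<phi>. configs_tendsto (\<lambda>t. X' t \<omega>) \<phi>)"
      using AE_tendsto_of_one_sided
    proof eventually_elim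
      case (elim \<omega>)
      have "\<forall>\<^sub>F t in sequentially. Rp \<le> left \<omega> t" if "liminf (\<lambda>t. ereal (left \<omega> t)) > ereal Rp"
        using less_LiminfD[OF that] by eventually_elim simp
      moreover have "\<forall>\<^sub>F t in sequentially. right \<omega> t \<le> Rm" if "limsup (\<lambda>t. ereal (right \<omega> t)) < ereal Rm"
        using Limsup_lessD[OF that] by eventually_elim simp
      ultimately show ?case using elim by blast
    qed
    assume "Rp < Rm"
    from AE_one_sided[OF this] AE_tendsto_of_one_sided
    have "AE \<omega> in M. \<exists>\<phi>. configs_tendsto (\<lambda>t. X' t \<omega>) \<phi>"
      by eventually_elim blast
    then show "\<P>(\<omega> in M. \<exists>\<phi>. configs_tendsto (\<lambda>t. X' t \<omega>) \<phi>) = 1"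
      using configs_tendsto_event by (subst prob_Collect_eq_1) auto
  qed
qed

end
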